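(* Let $N\ge1$ be an integer, $\mathcal G$ the metric star graph with $N$ infinite edges, $\gamma\in\mathbb R$, $t_0\in\mathbb R$, and let $\mathsf Q(x)=3^{1/4}(\cosh(2x))^{-1/2}$, $x\in\mathbb R$. For an initial datum $u_0\in H^1_D(\mathcal G)$ let $u$ be the maximal solution of $$ i u_t+u_{xx}-\gamma\delta u+|u|^4u=0\quad\text{on }\mathcal G,\qquad u(t_0)=u_0 . $$ (1) If $u_0\in H^1_D(\mathcal G)$ satisfies $\|u_0\|_{L^2(\mathcal G)}^2<\min\{1,\frac N2\}\|\mathsf Q\|_{L^2(\mathbb R)}^2$, then $u$ is global in $H^1(\mathcal G)$. Furthermore, if $\gamma>0$, then for any solution with $\|u_0\|_{L^2(\mathcal G)}^2=\min\{1,\frac N2\}\|\mathsf Q\|_{L^2(\mathbb R)}^2$, $|u(t,0)|$ remains bounded (on the maximal interval of existence). (2) If $u_0\in H^1_{\mathrm{rad}}(\mathcal G)$ satisfies $\|u_0\|_{L^2(\mathcal G)}^2<\frac N2\|\mathsf Q\|_{L^2(\mathbb R)}^2$, then $u$ is global in $H^1_{\mathrm{rad}}(\mathcal G)$. Furthermore, if $\gamma>0$, then for any solution with $u_0\in H^1_{\mathrm{rad}}(\mathcal G)$ and $\|u_0\|_{L^2(\mathcal G)}^2=\frac N2\|\mathsf Q\|_{L^2(\mathbb R)}^2$, $|u(t,0)|$ remains bounded (on the maximal interval of existence).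
   Context: Star graph: $\mathcal G$ consists of one vertex $0$ and $N$ edges, each identified with $[0,\infty)$, the endpoint $0$ being the vertex. A function on $\mathcal G$ is a collection $u=(u_1,\dots,u_N)$ of functions $u_j:[0,\infty)\to\mathbb C$; it is radial if all $u_j$ are equal. $L^p(\mathcal G)=\bigoplus_j L^p(0,\infty)$, $H^s(\mathcal G)=\bigoplus_j H^s(0,\infty)$ with the direct-sum norms $\|u\|_{L^p(\mathcal G)}^p=\sum_j\|u_j\|_{L^p}^p$, $\|u\|_{H^s(\mathcal G)}^2=\sum_j\|u_j\|_{H^s}^2$. $H^1_D(\mathcal G)=\{u\in H^1(\mathcal G): u_1(0)=\dots=u_N(0)=:u(0)\}$, and $H^1_{\mathrm{rad}}(\mathcal G)$ is the subspace of radial functions of $H^1(\mathcal G)$. Meaning of the equation: $iu_t-H_\gamma u+|u|^4u=0$ with $H_\gamma:H^1_D(\mathcal G)\to H^1_D(\mathcal G)^\star$, $\langle H_\gamma u,v\rangle=\mathrm{Re}\sum_j\int_0^\infty u_j'\overline{v_j'}\,dx+\gamma\,\mathrm{Re}(u(0)\overline{v(0)})$. For every $u_0\in H^1_D(\mathcal G)$ and $t_0\in\mathbb R$ there is a unique maximal solution $u\in C((T_{\min},T_{\max}),H^1_D(\mathcal G))\cap C^1((T_{\min},T_{\max}),H^1_D(\mathcal G)^\star)$ with $u(t_0)=u_0$; radial data give radial solutions; the quantities $E(u)=\frac12\|u_x\|_{L^2}^2+\frac\gamma2|u(0)|^2-\frac16\|u\|_{L^6}^6$ and $M(u)=\frac12\|u\|_{L^2}^2$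 are conserved; and the blow-up alternative holds: $T_{\max}=+\infty$ (resp. $T_{\min}=-\infty$) or $\|u(t)\|_{H^1(\mathcal G)}\to\infty$ as $t\to T_{\max}$ (resp. $T_{\min}$). "Global" means $T_{\min}=-\infty$ and $T_{\max}=+\infty$. *)

theory Defs
  imports "HOL-Analysis.Analysis"
begin

subsection \<open>Lebesgue and Sobolev spaces on the half-line\<close>

definition Lp_space :: "real measure \<Rightarrow> real \<Rightarrow> (real \<Rightarrow> complex) set" where
  "Lp_space M p = {f. f \<in> borel_measurable M \<and> integrable M (\<lambda>x. norm (f x) powr p)}"

definition Lp_norm :: "real measure \<Rightarrow> real \<Rightarrow> (real \<Rightarrow> 'a::real_normed_vector) \<Rightarrow> real" where
  "Lp_norm M p f = (LINT x|M. norm (f x) powr p) powr (1 / p)"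

abbreviation half_line :: "real measure" where
  "half_line \<equiv> lebesgue_on {0..}"

text \<open>The pair consisting of a real test function in \<open>C_c^1(0,\<infinity>)\<close> and its derivative. Once continuously
  differentiable test functions are the usual choice for Sobolev spaces on intervals, and real ones
  suffice for complex-valued \<open>f\<close> by linearity.\<close>
definition test_function :: "(real \<Rightarrow> real) \<Rightarrow> (real \<Rightarrow> real) \<Rightarrow> bool" where
  "test_function \<phi> \<phi>' \<longleftrightarrow>
     (\<forall>x. (\<phi> has_real_derivative \<phi>' x) (at x)) \<and> continuous_on UNIV \<phi>' \<and>
     compact (closure {x. \<phi> x \<noteq> 0}) \<and> closure {x. \<phi> x \<noteq> 0} \<subseteq> {0<..}"

definition has_L2_weak_deriv :: "(real \<Rightarrow> complex) \<Rightarrow> (real \<Rightarrow> complex) \<Rightarrow> bool" where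
  "has_L2_weak_deriv f g \<longleftrightarrow> g \<in> Lp_space half_line 2 \<and>
     (\<forall>\<phi> \<phi>'. test_function \<phi> \<phi>' \<longrightarrow>
        (LINT x|half_line. f x * complex_of_real (\<phi>' x)) =
        - (LINT x|half_line. g x * complex_of_real (\<phi> x)))"

text \<open>Elements of \<open>H\<^sup>1(0,\<infinity>)\<close> are taken as their continuous representatives on \<open>[0,\<infinity>)\<close>, so that the
  value at the endpoint is the plain function value. Values at negative arguments are
  irrelevant throughout.\<close>
definition H1_half :: "(real \<Rightarrow> complex) set" where
  "H1_half = {f \<in> Lp_space half_line 2. continuous_on {0..} f \<and> (\<exists>g. has_L2_weak_deriv f g)}"

text \<open>Determined up to null sets for \<open>f\<close> in \<^const>\<open>H1_half\<close>.\<close>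
definition weak_deriv :: "(real \<Rightarrow> complex) \<Rightarrow> real \<Rightarrow> complex" where
  "weak_deriv f = (SOME g. has_L2_weak_deriv f g)"

definition H1_half_norm :: "(real \<Rightarrow> complex) \<Rightarrow> real" where
  "H1_half_norm f =
     sqrt ((Lp_norm half_line 2 f)\<^sup>2 + (Lp_norm half_line 2 (weak_deriv f))\<^sup>2)"

subsection \<open>Function spaces on the star graph\<close>

text \<open>A function on the star graph with \<open>N\<close> edges is given by \<open>u j x\<close> for \<open>j \<in> {1..N}\<close>
  and \<open>x \<ge> 0\<close>; the values elsewhere are irrelevant.\<close>
type_synonym graph_fun = "nat \<Rightarrow> real \<Rightarrow> complex"

definition graph_eq :: "nat \<Rightarrow> graph_fun \<Rightarrow> graph_fun \<Rightarrow> bool" where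
  "graph_eq N u v \<longleftrightarrow> (\<forall>j\<in>{1..N}. \<forall>x\<ge>0. u j x = v j x)"

definition radial :: "nat \<Rightarrow> graph_fun \<Rightarrow> bool" where
  "radial N u \<longleftrightarrow> (\<forall>j\<in>{1..N}. \<forall>k\<in>{1..N}. \<forall>x\<ge>0. u j x = u k x)"

definition graph_Lp_norm :: "nat \<Rightarrow> real \<Rightarrow> graph_fun \<Rightarrow> real" where
  "graph_Lp_norm N p u = (\<Sum>j\<in>{1..N}. Lp_norm half_line p (u j) powr p) powr (1 / p)"

definition H1 :: "nat \<Rightarrow> graph_fun set" where
  "H1 N = {u. \<forall>j\<in>{1..N}. u j \<in> H1_half}"

definition H1_norm :: "nat \<Rightarrow> graph_fun \<Rightarrow> real" where
  "H1_norm N u = sqrt (\<Sum>j\<in>{1..N}. (H1_half_norm (u j))\<^sup>2)"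

definition H1_D :: "nat \<Rightarrow> graph_fun set" where
  "H1_D N = {u \<in> H1 N. \<forall>j\<in>{1..N}. \<forall>k\<in>{1..N}. u j 0 = u k 0}"

definition H1_rad :: "nat \<Rightarrow> graph_fun set" where
  "H1_rad N = {u \<in> H1 N. radial N u}"

text \<open>The common value at the vertex of a function in \<^const>\<open>H1_D\<close>, read off on the first edge.\<close>
definition vertex_value :: "graph_fun \<Rightarrow> complex" where
  "vertex_value u = u 1 0"

definition graph_deriv :: "graph_fun \<Rightarrow> graph_fun" where
  "graph_deriv u = (\<lambda>j. weak_deriv (u j))"

subsection \<open>The dual space\<close>

text \<open>\<^const>\<open>H1_D\<close> is regarded as a real space, in accordance with the real parts in the duality
  pairing. Boundedness forces functionals to respect \<^const>\<open>graph_eq\<close>.\<close>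
definition H1_D_dual :: "nat \<Rightarrow> (graph_fun \<Rightarrow> real) set" where
  "H1_D_dual N = {l.
     (\<forall>v\<in>H1_D N. \<forall>w\<in>H1_D N. \<forall>a b :: real.
        l (\<lambda>j x. of_real a * v j x + of_real b * w j x) = a * l v + b * l w) \<and>
     (\<exists>C. \<forall>v\<in>H1_D N. \<bar>l v\<bar> \<le> C * H1_norm N v)}"

definition dual_norm :: "nat \<Rightarrow> (graph_fun \<Rightarrow> real) \<Rightarrow> real" where
  "dual_norm N l = (SUP v\<in>{v \<in> H1_D N. H1_norm N v \<le> 1}. \<bar>l v\<bar>)"

text \<open>The real \<open>L\<^sup>2\<close> pairing, giving the embedding of functions into the dual.\<close>
definition L2_pairing :: "nat \<Rightarrow> graph_fun \<Rightarrow> graph_fun \<Rightarrow> real" where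
  "L2_pairing N u v = Re (\<Sum>j\<in>{1..N}. LINT x|half_line. u j x * cnj (v j x))"

definition H_op :: "nat \<Rightarrow> real \<Rightarrow> graph_fun \<Rightarrow> graph_fun \<Rightarrow> real" where
  "H_op N \<gamma> u v = L2_pairing N (graph_deriv u) (graph_deriv v) +
     \<gamma> * Re (vertex_value u * cnj (vertex_value v))"

text \<open>Multiplication by \<open>\<i>\<close> on the dual: \<open>Re (\<i> a cnj b) = Re (a cnj (- \<i> b))\<close>.\<close>
definition dual_mult_i :: "(graph_fun \<Rightarrow> real) \<Rightarrow> graph_fun \<Rightarrow> real" where
  "dual_mult_i l v = l (\<lambda>j x. - \<i> * v j x)"

definition quintic :: "graph_fun \<Rightarrow> graph_fun" where
  "quintic u = (\<lambda>j x. of_real (norm (u j x) ^ 4) * u j x)"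

subsection \<open>Solutions of the nonlinear Schroedinger equation\<close>

definition time_interval :: "ereal \<Rightarrow> ereal \<Rightarrow> real set" where
  "time_interval Tmin Tmax = {t. Tmin < ereal t \<and> ereal t < Tmax}"

definition continuous_H1 :: "nat \<Rightarrow> real set \<Rightarrow> (real \<Rightarrow> graph_fun) \<Rightarrow> bool" where
  "continuous_H1 N I u \<longleftrightarrow>
     (\<forall>t\<in>I. ((\<lambda>s. H1_norm N (\<lambda>j x. u s j x - u t j x)) \<longlongrightarrow> 0) (at t within I))"

text \<open>\<open>u\<close>, as a curve in the dual space, is continuously differentiable in the dual norm with
  derivative \<open>du\<close>.\<close>
definition C1_dual ::
  "nat \<Rightarrow> real set \<Rightarrow> (real \<Rightarrow> graph_fun) \<Rightarrow> (real \<Rightarrow> graph_fun \<Rightarrow> real) \<Rightarrow> bool" where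
  "C1_dual N I u du \<longleftrightarrow>
     (\<forall>t\<in>I. du t \<in> H1_D_dual N \<and>
        ((\<lambda>s. dual_norm N (\<lambda>v. (L2_pairing N (u s) v - L2_pairing N (u t) v) / (s - t) - du t v))
           \<longlongrightarrow> 0) (at t within I) \<and>
        ((\<lambda>s. dual_norm N (\<lambda>v. du s v - du t v)) \<longlongrightarrow> 0) (at t within I))"

definition nls_solution ::
  "nat \<Rightarrow> real \<Rightarrow> ereal \<Rightarrow> ereal \<Rightarrow> (real \<Rightarrow> graph_fun) \<Rightarrow> bool" where
  "nls_solution N \<gamma> Tmin Tmax u \<longleftrightarrow> (let I = time_interval Tmin Tmax in
     (\<forall>t\<in>I. u t \<in> H1_D N) \<and> continuous_H1 N I u \<and>
     (\<exists>du. C1_dual N I u du \<and>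
        (\<forall>t\<in>I. \<forall>v\<in>H1_D N.
           dual_mult_i (du t) v - H_op N \<gamma> (u t) v + L2_pairing N (quintic (u t)) v = 0)))"

definition maximal_solution ::
  "nat \<Rightarrow> real \<Rightarrow> real \<Rightarrow> graph_fun \<Rightarrow> ereal \<Rightarrow> ereal \<Rightarrow> (real \<Rightarrow> graph_fun) \<Rightarrow> bool" where
  "maximal_solution N \<gamma> t0 u0 Tmin Tmax u \<longleftrightarrow>
     t0 \<in> time_interval Tmin Tmax \<and> nls_solution N \<gamma> Tmin Tmax u \<and> graph_eq N (u t0) u0 \<and>
     (\<forall>Smin Smax w. Smin \<le> Tmin \<and> Tmax \<le> Smax \<and> nls_solution N \<gamma> Smin Smax w \<and>
        (\<forall>t\<in>time_interval Tmin Tmax. graph_eq N (w t) (u t)) \<longrightarrow> Smin = Tmin \<and> Smax = Tmax)"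

definition energy :: "nat \<Rightarrow> real \<Rightarrow> graph_fun \<Rightarrow> real" where
  "energy N \<gamma> u = (1/2) * (graph_Lp_norm N 2 (graph_deriv u))\<^sup>2
     + (\<gamma>/2) * (norm (vertex_value u))\<^sup>2 - (1/6) * (graph_Lp_norm N 6 u) ^ 6"

definition mass :: "nat \<Rightarrow> graph_fun \<Rightarrow> real" where
  "mass N u = (1/2) * (graph_Lp_norm N 2 u)\<^sup>2"

text \<open>The known local theory of the Cauchy problem in \<^const>\<open>H1_D\<close>: for all data there is a
  unique maximal solution; it is radial if the data are; energy and mass are conserved; and the
  blow-up alternative holds at both ends. This is background for the results on global existence
  and enters them as a hypothesis.\<close>
definition local_cauchy_theory :: "nat \<Rightarrow> real \<Rightarrow> bool" where
  "local_cauchy_theory N \<gamma> \<longleftrightarrow> (\<forall>t0. \<forall>u0\<in>H1_D N.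
     (\<exists>Tmin Tmax u. maximal_solution N \<gamma> t0 u0 Tmin Tmax u) \<and>
     (\<forall>Tmin Tmax u. maximal_solution N \<gamma> t0 u0 Tmin Tmax u \<longrightarrow>
        (\<forall>Smin Smax w. maximal_solution N \<gamma> t0 u0 Smin Smax w \<longrightarrow>
           Smin = Tmin \<and> Smax = Tmax \<and> (\<forall>t\<in>time_interval Tmin Tmax. graph_eq N (w t) (u t))) \<and>
        (radial N u0 \<longrightarrow> (\<forall>t\<in>time_interval Tmin Tmax. radial N (u t))) \<and>
        (\<forall>t\<in>time_interval Tmin Tmax.
           energy N \<gamma> (u t) = energy N \<gamma> u0 \<and> mass N (u t) = mass N u0) \<and>
        (Tmax = \<infinity> \<or>
           filterlim (\<lambda>t. H1_norm N (u t)) at_top (at_left (real_of_ereal Tmax))) \<and>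
        (Tmin = -\<infinity> \<or>
           filterlim (\<lambda>t. H1_norm N (u t)) at_top (at_right (real_of_ereal Tmin)))))"

definition global_interval :: "ereal \<Rightarrow> ereal \<Rightarrow> bool" where
  "global_interval Tmin Tmax \<longleftrightarrow> Tmin = -\<infinity> \<and> Tmax = \<infinity>"

definition Q :: "real \<Rightarrow> real" where
  "Q x = 3 powr (1/4) * cosh (2 * x) powr (-1/2)"

end

theory Submission
  imports Defs
begin

text \<open>On one edge put \<open>s = \<bar>f\<bar>\<close> and let \<open>q\<close> solve \<open>q' = 2 (k\<^sup>2 + q\<^sup>2) s\<^sup>2\<close>. Then
  \<open>s'\<^sup>2 + (q s\<^sup>4 / 2)' - k\<^sup>2 s\<^sup>6 = (s' + q s\<^sup>3)\<^sup>2 \<ge> 0\<close>, and integrating gives a sharp Gagliardo--Nirenberg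
  inequality on the half-line with the vertex term \<open>(k/2) cot (2 k \<parallel>f\<parallel>\<^sup>2 + \<epsilon>) \<bar>f 0\<bar>\<^sup>4\<close>. Summed over
  the edges, the cotangents have nonnegative sum as soon as their arguments add up to at most \<open>\<pi>\<close> and
  there are at least two of them, or all of them are at most \<open>\<pi>/2\<close> (the radial case); no rearrangement
  is needed. As \<open>\<parallel>Q\<parallel>\<^sup>2 = \<surd>3 \<pi> / 2\<close>, the critical masses correspond to \<open>k = 1/\<surd>3\<close>, the value at which
  the inequality balances the energy. So the energy controls the \<open>H\<^sup>1\<close> norm below the critical mass, and
  the vertex value at it if \<open>\<gamma> > 0\<close>.\<close>

section \<open>Increments of functions with a weak derivative\<close>

definition hat :: "real \<Rightarrow> real" where
  "hat x = max 0 x - 2 * max 0 (x - 1) + max 0 (x - 2)"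

text \<open>The quadratic spline primitive of \<open>hat\<close>, climbing from 0 to 1 on
  \<open>{0..2}\<close>. It is once continuously differentiable, as \<open>test_function\<close>
  demands; writing both splines with ramps \<open>max 0 x\<close> spares a piecewise
  definition.\<close>

definition smooth_step :: "real \<Rightarrow> real" where
  "smooth_step x = ((max 0 x)\<^sup>2 - 2 * (max 0 (x - 1))\<^sup>2 + (max 0 (x - 2))\<^sup>2) / 2"

text \<open>Only the origin is delicate: there the difference quotient is bounded by
  \<open>\<bar>h\<bar>\<close>.\<close>

lemma has_real_derivative_ramp_square:
  "((\<lambda>x::real. (max 0 x)\<^sup>2) has_real_derivative 2 * max 0 x) (at x)"
proof (cases "x = 0")
  case True
  have "((\<lambda>h::real. (max 0 h)\<^sup>2 / h) \<longlongrightarrow> 0) (at 0)"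
  proof (rule Lim_null_comparison)
    show "\<forall>\<^sub>F h::real in at 0. norm ((max 0 h)\<^sup>2 / h) \<le> \<bar>h\<bar>"
      by (auto simp: max_def power2_eq_square)
    show "((\<lambda>h::real. \<bar>h\<bar>) \<longlongrightarrow> 0) (at 0)"
      by (rule tendsto_eq_intros refl | simp)+
  qed
  then show ?thesis using True by (simp add: DERIV_def)
next
  case False
  show ?thesis
  proof (cases "x > 0")
    case True
    have "((\<lambda>x::real. x\<^sup>2) has_real_derivative 2 * max 0 x) (at x)"
      using True by (auto intro!: derivative_eq_intros)
    then show ?thesis
      by (rule has_field_derivative_transform_within_open[where S="{0<..}"]) (use True in auto)
  next
    case nonpos: False
    have "((\<lambda>x::real. 0) has_real_derivative 2 * max 0 x) (at x)"
      using nonpos by (auto intro!: derivative_eq_intros)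
    then show ?thesis
      by (rule has_field_derivative_transform_within_open[where S="{..<0}"]) (use nonpos False in auto)
  qed
qed

lemma has_real_derivative_smooth_step:
  "(smooth_step has_real_derivative hat x) (at x)"
proof -
  have shift: "((\<lambda>x::real. (max 0 (x - c))\<^sup>2) has_real_derivative 2 * max 0 (x - c)) (at x)" for c
  proof -
    have "((\<lambda>x. x - c) has_real_derivative 1) (at x)"
      by (auto intro!: derivative_eq_intros)
    from DERIV_chain2[OF has_real_derivative_ramp_square this] show ?thesis
      by simp
  qed
  show ?thesis
    unfolding smooth_step_def[abs_def] hat_def
    by (rule DERIV_cong[OF DERIV_cdivide[OF DERIV_add[OF DERIV_diff[OF
            has_real_derivative_ramp_square DERIV_cmult[OF shift]] shift]]]) simp
qed

lemma hat_nonneg: "0 \<le> hat x"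
  by (auto simp: hat_def max_def)

lemma hat_eq_0: "x \<notin> {0..2} \<Longrightarrow> hat x = 0"
  by (auto simp: hat_def max_def)

lemma smooth_step_eq_0: "x \<le> 0 \<Longrightarrow> smooth_step x = 0"
  by (simp add: smooth_step_def)

lemma smooth_step_eq_1: "2 \<le> x \<Longrightarrow> smooth_step x = 1"
  by (simp add: smooth_step_def max_def power2_eq_square algebra_simps)

lemma smooth_step_mono: "x \<le> y \<Longrightarrow> smooth_step x \<le> smooth_step y"
  by (rule DERIV_nonneg_imp_nondecreasing) (auto intro: has_real_derivative_smooth_step hat_nonneg)

lemma smooth_step_bounds: "0 \<le> smooth_step x" "smooth_step x \<le> 1"
  using smooth_step_mono[of "min 0 x" x] smooth_step_eq_0[of "min 0 x"]
    smooth_step_mono[of x "max 2 x"] smooth_step_eq_1[of "max 2 x"] by auto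

lemma continuous_on_hat [continuous_intros]:
  "continuous_on S f \<Longrightarrow> continuous_on S (\<lambda>x. hat (f x))"
  unfolding hat_def by (intro continuous_intros)

lemma has_real_derivative_smooth_step_scaled:
  assumes "d > 0"
  shows "((\<lambda>x. smooth_step ((x - a) / d)) has_real_derivative hat ((x - a) / d) / d) (at x)"
proof -
  have "((\<lambda>x. (x - a) / d) has_real_derivative 1 / d) (at x)"
    using assms by (auto intro!: derivative_eq_intros)
  from DERIV_chain2[OF has_real_derivative_smooth_step this] show ?thesis
    by simp
qed

text \<open>One step up starts at \<open>a\<close>, one step down at \<open>b\<close>. The
  derivative is an approximate Dirac mass at \<open>a\<close> minus one at \<open>b\<close>, so
  testing with this bump produces increments of \<open>f\<close>. Positivity of \<open>a\<close>
  keeps the closed support away from the vertex.\<close>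

lemma test_function_smooth_step_diff:
  assumes "0 < a" "a \<le> b" "0 < d"
  shows "test_function (\<lambda>x. smooth_step ((x - a) / d) - smooth_step ((x - b) / d))
           (\<lambda>x. hat ((x - a) / d) / d - hat ((x - b) / d) / d)"
proof -
  let ?\<phi> = "\<lambda>x. smooth_step ((x - a) / d) - smooth_step ((x - b) / d)"
  have "{x. ?\<phi> x \<noteq> 0} \<subseteq> {a..b + 2 * d}"
  proof (rule subsetI, rule ccontr)
    fix x assume x: "x \<in> {x. ?\<phi> x \<noteq> 0}" and "x \<notin> {a..b + 2 * d}"
    then consider "x < a" | "x > b + 2 * d" by force
    then have "?\<phi> x = 0"
    proof cases
      case 1
      then show ?thesis using assms by (simp add: smooth_step_eq_0 field_simps)
    next
      case 2
      then show ?thesis using assms by (simp add: smooth_step_eq_1 field_simps)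
    qed
    then show False using x by simp
  qed
  then have cl: "closure {x. ?\<phi> x \<noteq> 0} \<subseteq> {a..b + 2 * d}"
    by (rule closure_minimal) simp
  moreover have "compact (closure {x. ?\<phi> x \<noteq> 0})"
    using cl by (simp add: compact_closure) (meson bounded_closed_interval bounded_subset closure_subset order_trans)
  moreover have "closure {x. ?\<phi> x \<noteq> 0} \<subseteq> {0<..}"
    using cl assms by auto
  moreover have "continuous_on UNIV (\<lambda>x. hat ((x - a) / d) / d - hat ((x - b) / d) / d)"
    using assms by (intro continuous_intros) auto
  ultimately show ?thesis
    unfolding test_function_def
    using assms by (auto intro!: derivative_eq_intros has_real_derivative_smooth_step_scaled)
qed

lemma has_integral_hat_scaled:
  assumes "d > 0"
  shows "((\<lambda>x. hat ((x - a) / d) / d) has_integral 1) {a..a + 2 * d}"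
proof -
  have "((\<lambda>x. hat ((x - a) / d) / d) has_integral
      smooth_step ((a + 2 * d - a) / d) - smooth_step ((a - a) / d)) {a..a + 2 * d}"
    by (rule fundamental_theorem_of_calculus)
      (use assms in \<open>auto simp flip: has_real_derivative_iff_has_vector_derivative
        intro!: has_field_derivative_at_within has_real_derivative_smooth_step_scaled\<close>)
  then show ?thesis using assms by (simp add: smooth_step_eq_0 smooth_step_eq_1)
qed

text \<open>Translates Lebesgue integrals over the half-line into gauge integrals over a compact
  interval carrying the function.\<close>

lemma half_line_supported:
  fixes h :: "real \<Rightarrow> 'a::euclidean_space"
  assumes "0 \<le> a" and int: "h absolutely_integrable_on {a..b}" and supp: "\<And>x. 0 \<le> x \<Longrightarrow> x \<notin> {a..b} \<Longrightarrow> h x = 0"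
  shows "integrable half_line h" "(LINT x|half_line. h x) = integral {a..b} h"
proof -
  have eq: "indicator {0..} x *\<^sub>R h x = indicator {a..b} x *\<^sub>R h x" for x
    using assms by (auto simp: indicator_def)
  show "integrable half_line h"
    using int by (simp add: integrable_restrict_space eq set_integrable_def)
  have "(LINT x|half_line. h x) = (LINT x|lebesgue. indicator {a..b} x *\<^sub>R h x)"
    by (simp add: integral_restrict_space eq)
  also have "\<dots> = integral {a..b} h"
    using set_lebesgue_integral_eq_integral(2)[OF int] by (simp add: set_lebesgue_integral_def)
  finally show "(LINT x|half_line. h x) = integral {a..b} h" .
qed

text \<open>The weights have mass one and live on \<open>{a..a + 2 * d}\<close>, so they average
  \<open>f\<close> over points to the right of \<open>a\<close> only, where continuity on the closed
  half-line applies.\<close>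

lemma tendsto_integral_hat:
  fixes f :: "real \<Rightarrow> complex"
  assumes f: "continuous_on {0..} f" and a: "0 \<le> a"
  shows "((\<lambda>d. integral {a..a + 2 * d} (\<lambda>x. f x * of_real (hat ((x - a) / d) / d))) \<longlongrightarrow> f a)
    (at_right 0)"
proof (rule tendstoI)
  fix e :: real assume "e > 0"
  then obtain r where r: "r > 0" "\<And>x. x \<in> {0..} \<Longrightarrow> dist x a < r \<Longrightarrow> dist (f x) (f a) < e / 2"
    using f a unfolding continuous_on_iff by (metis atLeast_iff half_gt_zero)
  \<comment> \<open>The bound \<open>d < r / 2\<close> places the whole support of the weight within
    distance \<open>r\<close> of \<open>a\<close>.\<close>
  have "dist (integral {a..a + 2 * d} (\<lambda>x. f x * of_real (hat ((x - a) / d) / d))) (f a) < e"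
    if d: "0 < d" "d < r / 2" for d
  proof -
    let ?w = "\<lambda>x. hat ((x - a) / d) / d"
    have w: "(?w has_integral 1) {a..a + 2 * d}"
      using has_integral_hat_scaled d by blast
    have "((\<lambda>x. f a * of_real (?w x)) has_integral f a * of_real 1) {a..a + 2 * d}"
      using has_integral_mult_right[OF has_integral_of_real[OF w]] by blast
    moreover have "(\<lambda>x. f x * of_real (?w x)) integrable_on {a..a + 2 * d}"
      by (rule integrable_continuous_interval)
        (use a d in \<open>auto intro!: continuous_intros continuous_on_subset[OF f]\<close>)
    ultimately have "((\<lambda>x. f x * of_real (?w x) - f a * of_real (?w x)) has_integral
        integral {a..a + 2 * d} (\<lambda>x. f x * of_real (?w x)) - f a) {a..a + 2 * d}"
      by (intro has_integral_diff[OF integrable_integral]) simp_all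
    then have *: "integral {a..a + 2 * d} (\<lambda>x. f x * of_real (?w x) - f a * of_real (?w x)) =
        integral {a..a + 2 * d} (\<lambda>x. f x * of_real (?w x)) - f a"
      "(\<lambda>x. f x * of_real (?w x) - f a * of_real (?w x)) integrable_on {a..a + 2 * d}"
      by (auto simp: integral_unique integrable_on_def)
    have "((\<lambda>x. e / 2 * ?w x) has_integral e / 2 * 1) {a..a + 2 * d}"
      using has_integral_mult_right[OF w] by blast
    then have "norm (integral {a..a + 2 * d} (\<lambda>x. f x * of_real (?w x) - f a * of_real (?w x))) \<le> e / 2"
    proof -
      assume e2: "((\<lambda>x. e / 2 * ?w x) has_integral e / 2 * 1) {a..a + 2 * d}"
      have "norm (integral {a..a + 2 * d} (\<lambda>x. f x * of_real (?w x) - f a * of_real (?w x)))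
        \<le> integral {a..a + 2 * d} (\<lambda>x. e / 2 * ?w x)"
      proof (rule integral_norm_bound_integral)
        fix x assume x: "x \<in> {a..a + 2 * d}"
        have "norm (f x - f a) \<le> e / 2"
          using r(2)[of x] x a d by (auto simp: dist_norm)
        moreover have "0 \<le> ?w x" using d by (simp add: hat_nonneg)
        ultimately have "norm (f x - f a) * ?w x \<le> e / 2 * ?w x"
          by (rule mult_right_mono)
        then show "norm (f x * of_real (?w x) - f a * of_real (?w x)) \<le> e / 2 * ?w x"
          using \<open>0 \<le> ?w x\<close> by (simp only: flip: left_diff_distrib) (simp only: norm_mult norm_of_real abs_of_nonneg)
      qed (use * e2 in \<open>auto simp: integrable_on_def\<close>)
      then show ?thesis using integral_unique[OF e2] by (simp only: mult_1_right)
    qed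
    then show ?thesis using * \<open>e > 0\<close> by (simp add: dist_norm)
  qed
  then show "\<forall>\<^sub>F d in at_right 0. dist (integral {a..a + 2 * d} (\<lambda>x. f x * of_real (hat ((x - a) / d) / d))) (f a) < e"
    using r(1) by (intro eventually_at_rightI[of 0 "r / 2"]) auto
qed

section \<open>Half-line integrals against integrals over compact intervals\<close>

lemma Lp_space_2D:
  assumes "g \<in> Lp_space M 2"
  shows "g \<in> borel_measurable M" "integrable M (\<lambda>x. (norm (g x))\<^sup>2)"
  using assms by (auto simp: Lp_space_def powr_numeral)

lemma half_line_integrable_on:
  fixes F :: "real \<Rightarrow> real"
  assumes "integrable half_line F" "\<And>x. 0 \<le> F x" "0 \<le> a"
  shows "F absolutely_integrable_on {a..b}"
proof -
  have "F absolutely_integrable_on {0..}"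
    using assms(1) by (simp add: integrable_restrict_space set_integrable_def)
  then show ?thesis
    by (rule set_integrable_subset) (use assms in auto)
qed

lemma integral_le_half_line:
  fixes F :: "real \<Rightarrow> real"
  assumes F: "integrable half_line F" "\<And>x. 0 \<le> F x" and "0 \<le> a"
  shows "integral {a..b} F \<le> (LINT x|half_line. F x)"
proof -
  have "integral {a..b} F \<le> integral {0..} F"
  proof (rule integral_subset_le)
    show "F integrable_on {a..b}"
      using half_line_integrable_on[OF assms] set_lebesgue_integral_eq_integral(1) by blast
    show "F integrable_on {0..}"
      using F(1) by (rule integrable_on_lebesgue_on) simp
  qed (use assms in auto)
  also have "integral {0..} F = (LINT x|half_line. F x)"
    using F(1) by (subst lebesgue_integral_eq_integral) auto
  finally show ?thesis .
qed

text \<open>A nonintegrable \<open>F\<close> has integral 0 by convention, and then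
  \<open>R = 0\<close> gives \<open>0 \<le> B\<close>. Hence the sixth power of a function can be
  bounded before its integrability is known.\<close>

lemma half_line_integral_le_bound:
  fixes F :: "real \<Rightarrow> real"
  assumes le: "\<And>R. 0 \<le> R \<Longrightarrow> integral {0..R} F \<le> B"
  shows "(LINT x|half_line. F x) \<le> B"
proof (cases "integrable half_line F")
  case True
  then have si: "set_integrable lebesgue {0..} F"
    by (simp add: integrable_restrict_space set_integrable_def)
  then have "((\<lambda>R. set_lebesgue_integral lebesgue {0..R} F) \<longlongrightarrow> set_lebesgue_integral lebesgue {0..} F) at_top"
    by (intro tendsto_set_lebesgue_integral_at_top) auto
  moreover have "\<forall>\<^sub>F R in at_top. set_lebesgue_integral lebesgue {0..R} F \<le> B"
    using eventually_ge_at_top[of 0]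
  proof eventually_elim
    case (elim R)
    have "set_integrable lebesgue {0..R} F"
      using si by (rule set_integrable_subset) auto
    from set_lebesgue_integral_eq_integral(2)[OF this] le[OF elim] show ?case by simp
  qed
  ultimately have "set_lebesgue_integral lebesgue {0..} F \<le> B"
    by (intro tendsto_upperbound) auto
  then show ?thesis
    by (simp add: integral_restrict_space set_lebesgue_integral_def)
next
  case False
  then show ?thesis using le[of 0] by (simp add: not_integrable_integral_eq)
qed

text \<open>The bound \<open>\<bar>f b - f a\<bar>\<^sup>2 \<le> (b - a) \<integral> \<bar>g\<bar>\<^sup>2\<close>, kept linear in the increment by a free parameter \<open>c\<close>.
  It is the only consequence of weak differentiability that is needed.\<close>
lemma H1_increment_pos:
  fixes f g :: "real \<Rightarrow> complex"
  assumes f: "continuous_on {0..} f" and g: "has_L2_weak_deriv f g"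
    and ab: "0 < a" "a \<le> b" and c: "0 \<le> c"
  shows "2 * c * norm (f b - f a) \<le> integral {a..b} (\<lambda>x. (norm (g x))\<^sup>2) + c\<^sup>2 * (b - a)"
proof -
  define A where "A a d = integral {a..a + 2 * d} (\<lambda>x. f x * of_real (hat ((x - a) / d) / d))" for a d
  define G where "G x = integral {a..x} (\<lambda>x. (norm (g x))\<^sup>2)" for x
  have g2: "g \<in> borel_measurable half_line" "integrable half_line (\<lambda>x. (norm (g x))\<^sup>2)"
    using g Lp_space_2D unfolding has_L2_weak_deriv_def by auto
  have gint: "(\<lambda>x. (norm (g x))\<^sup>2) absolutely_integrable_on {a..x}" for x
    using half_line_integrable_on[OF g2(2)] ab by simp
  \<comment> \<open>The estimate for the mollified values: their difference is the integral of
    \<open>g\<close> against a bump of height at most 1 supported in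
    \<open>{a..b + 2 * d}\<close>.\<close>
  have bound: "2 * c * norm (A b d - A a d) \<le> G (b + 2 * d) + c\<^sup>2 * (b + 2 * d - a)" if d: "0 < d" for d
  proof -
    let ?\<phi> = "\<lambda>x. smooth_step ((x - a) / d) - smooth_step ((x - b) / d)"
    let ?h = "\<lambda>a x. f x * of_real (hat ((x - a) / d) / d)"
    have h: "integrable half_line (?h p)" "(LINT x|half_line. ?h p x) = A p d" if "0 \<le> p" for p
    proof -
      have supp: "?h p x = 0" if "x \<notin> {p..p + 2 * d}" for x
        using that d by (subst hat_eq_0) (auto simp: field_simps)
      have "?h p absolutely_integrable_on {p..p + 2 * d}"
        by (rule absolutely_integrable_continuous_real)
          (use \<open>0 \<le> p\<close> d in \<open>auto intro!: continuous_intros continuous_on_subset[OF f]\<close>)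
      from half_line_supported[OF \<open>0 \<le> p\<close> this supp]
      show "integrable half_line (?h p)" "(LINT x|half_line. ?h p x) = A p d"
        by (auto simp: A_def)
    qed
    have "(LINT x|half_line. f x * complex_of_real (hat ((x - a) / d) / d - hat ((x - b) / d) / d)) =
        - (LINT x|half_line. g x * complex_of_real (?\<phi> x))"
      using g test_function_smooth_step_diff[OF ab d] unfolding has_L2_weak_deriv_def by blast
    moreover have "(LINT x|half_line. f x * complex_of_real (hat ((x - a) / d) / d - hat ((x - b) / d) / d)) =
        (LINT x|half_line. ?h a x - ?h b x)"
      by (simp add: algebra_simps)
    moreover have "\<dots> = A a d - A b d"
      using h[of a] h[of b] ab by (subst Bochner_Integration.integral_diff) auto
    ultimately have eq: "A b d - A a d = (LINT x|half_line. g x * complex_of_real (?\<phi> x))"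
      by (metis minus_diff_eq minus_minus)
    \<comment> \<open>The majorant comes from
      \<open>2 * c * norm (g x) \<le> (norm (g x))\<^sup>2 + c\<^sup>2\<close>, cut off to the
      support of the bump.\<close>
    let ?F = "\<lambda>x. indicator {a..b + 2 * d} x * ((norm (g x))\<^sup>2 + c\<^sup>2)"
    have Fint: "?F absolutely_integrable_on {a..b + 2 * d}"
    proof -
      have "(\<lambda>x. (norm (g x))\<^sup>2 + c\<^sup>2) absolutely_integrable_on {a..b + 2 * d}"
        by (intro set_integral_add gint absolutely_integrable_continuous_real continuous_intros)
      then show ?thesis
        by (rule set_integrable_cong[THEN iffD1, rotated 3]) auto
    qed
    have F: "integrable half_line ?F" "(LINT x|half_line. ?F x) = integral {a..b + 2 * d} ?F"
      using half_line_supported[OF _ Fint] ab by auto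
    have "2 * c * norm (A b d - A a d) \<le> 2 * c * (LINT x|half_line. norm (g x * complex_of_real (?\<phi> x)))"
      unfolding eq using c by (intro mult_left_mono integral_norm_bound) auto
    also have "\<dots> = (LINT x|half_line. 2 * c * norm (g x * complex_of_real (?\<phi> x)))"
      by simp
    also have "\<dots> \<le> (LINT x|half_line. ?F x)"
    proof (rule integral_mono'[OF F(1)])
      fix x assume "x \<in> space half_line"
      then have x: "0 \<le> x" by simp
      show "2 * c * norm (g x * complex_of_real (?\<phi> x)) \<le> ?F x"
      proof (cases "x \<in> {a..b + 2 * d}")
        case True
        have "\<bar>?\<phi> x\<bar> \<le> 1"
          using smooth_step_bounds[of "(x - a) / d"] smooth_step_bounds[of "(x - b) / d"] by linarith
        then have "norm (g x) * \<bar>?\<phi> x\<bar> \<le> norm (g x) * 1"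
          by (intro mult_left_mono) auto
        then have "2 * c * (norm (g x) * \<bar>?\<phi> x\<bar>) \<le> 2 * c * norm (g x)"
          using c by (intro mult_left_mono) auto
        also have "\<dots> \<le> (norm (g x))\<^sup>2 + c\<^sup>2"
          using sum_squares_bound[of c "norm (g x)"] by (simp add: algebra_simps)
        finally have "2 * c * (norm (g x) * \<bar>?\<phi> x\<bar>) \<le> (norm (g x))\<^sup>2 + c\<^sup>2" .
        then show ?thesis using True by (simp add: norm_mult del: of_real_diff)
      next
        case False
        then consider "x < a" | "x > b + 2 * d" by force
        then have "?\<phi> x = 0"
        proof cases
          case 1
          then show ?thesis using ab d by (simp add: smooth_step_eq_0 field_simps)
        next
          case 2
          then show ?thesis using ab d by (simp add: smooth_step_eq_1 field_simps)
        qed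
        then show ?thesis by (simp del: of_real_diff)
      qed
    qed (simp add: indicator_def)
    also have "\<dots> = integral {a..b + 2 * d} (\<lambda>x. (norm (g x))\<^sup>2 + c\<^sup>2)"
      unfolding F(2) by (rule integral_cong) auto
    also have "\<dots> = G (b + 2 * d) + c\<^sup>2 * (b + 2 * d - a)"
      using set_lebesgue_integral_eq_integral(1)[OF gint] ab d
      by (subst integral_add) (auto simp: G_def)
    finally show ?thesis .
  qed
  have lim1: "((\<lambda>d. 2 * c * norm (A b d - A a d)) \<longlongrightarrow> 2 * c * norm (f b - f a)) (at_right 0)"
    unfolding A_def using ab by (intro tendsto_intros tendsto_integral_hat f) auto
  have Gcont: "continuous_on {a..b + 2} G"
    unfolding G_def using set_lebesgue_integral_eq_integral(1)[OF gint]
    by (rule indefinite_integral_continuous_1)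
  have lim2: "((\<lambda>d. G (b + 2 * d)) \<longlongrightarrow> G b) (at_right 0)"
  proof -
    have "(G \<longlongrightarrow> G b) (at b within {a..b + 2})"
      using Gcont ab by (auto simp: continuous_on_def)
    moreover have "filterlim (\<lambda>d. b + 2 * d) (at b within {a..b + 2}) (at_right (0::real))"
      unfolding filterlim_at
    proof
      show "\<forall>\<^sub>F d in at_right 0. b + 2 * d \<in> {a..b + 2} \<and> b + 2 * d \<noteq> b"
        using ab by (intro eventually_at_rightI[of 0 1]) auto
      show "((\<lambda>d. b + 2 * d) \<longlongrightarrow> b) (at_right 0)"
        by (rule tendsto_eq_intros refl | simp)+
    qed
    ultimately show ?thesis by (rule filterlim_compose)
  qed
  have lim3: "((\<lambda>d. G (b + 2 * d) + c\<^sup>2 * (b + 2 * d - a)) \<longlongrightarrow> G b + c\<^sup>2 * (b + 2 * 0 - a)) (at_right 0)"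
    by (intro tendsto_intros lim2)
  have "2 * c * norm (f b - f a) \<le> G b + c\<^sup>2 * (b + 2 * 0 - a)"
    by (rule tendsto_le[OF _ lim3 lim1])
      (use bound in \<open>auto simp: eventually_at_filter\<close>)
  then show ?thesis by (simp add: G_def)
qed

text \<open>Test functions vanish near the vertex, so \<open>a = 0\<close> is reached by a limit:
  both sides are continuous in the left endpoint.\<close>

lemma H1_increment:
  fixes f g :: "real \<Rightarrow> complex"
  assumes f: "continuous_on {0..} f" and g: "has_L2_weak_deriv f g"
    and ab: "0 \<le> a" "a \<le> b" and c: "0 \<le> c"
  shows "2 * c * norm (f b - f a) \<le> integral {a..b} (\<lambda>x. (norm (g x))\<^sup>2) + c\<^sup>2 * (b - a)"
proof (cases "a = b")
  case False
  with ab have "a < b" by simp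
  have "integrable half_line (\<lambda>x. (norm (g x))\<^sup>2)"
    using g Lp_space_2D unfolding has_L2_weak_deriv_def by auto
  then have "(\<lambda>x. (norm (g x))\<^sup>2) absolutely_integrable_on {a..b}"
    using half_line_integrable_on ab by simp
  then have "(\<lambda>x. (norm (g x))\<^sup>2) integrable_on {a..b}"
    by (rule set_lebesgue_integral_eq_integral(1))
  then have G: "continuous_on {a..b} (\<lambda>x. integral {x..b} (\<lambda>x. (norm (g x))\<^sup>2))"
    by (rule indefinite_integral_continuous_1')
  have at: "at_right a = at a within {a..b}"
    using \<open>a < b\<close> by (simp add: at_within_Icc_at_right)
  have "((\<lambda>x. 2 * c * norm (f b - f x)) \<longlongrightarrow> 2 * c * norm (f b - f a)) (at_right a)"
    unfolding at using continuous_on_subset[OF f, of "{a..b}"] ab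
    by (intro tendsto_intros) (auto simp: continuous_on_def)
  moreover have "((\<lambda>x. integral {x..b} (\<lambda>x. (norm (g x))\<^sup>2) + c\<^sup>2 * (b - x)) \<longlongrightarrow>
      integral {a..b} (\<lambda>x. (norm (g x))\<^sup>2) + c\<^sup>2 * (b - a)) (at_right a)"
    unfolding at using G ab by (intro tendsto_intros) (auto simp: continuous_on_def)
  moreover have "\<forall>\<^sub>F x in at_right a. 2 * c * norm (f b - f x) \<le> integral {x..b} (\<lambda>x. (norm (g x))\<^sup>2) + c\<^sup>2 * (b - x)"
    by (rule eventually_at_rightI[of a b]) (use \<open>a < b\<close> ab c in \<open>auto intro!: H1_increment_pos f g\<close>)
  ultimately show ?thesis
    by (intro tendsto_le[where F="at_right a"]) auto
qed simp

section \<open>The sharp inequality on the half-line\<close>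

text \<open>Each endpoint contributes an error of at most \<open>e / 2\<close> times its distance to
  \<open>x\<close>; since \<open>x\<close> lies between the endpoints, these distances add up to
  exactly the length of the interval.\<close>

lemma straddle_quotient_tendsto:
  fixes q :: "real \<Rightarrow> real"
  assumes "(q has_real_derivative D) (at x within I)" "x \<in> I"
  shows "((\<lambda>p. (q (snd p) - q (fst p)) / (snd p - fst p)) \<longlongrightarrow> D)
    (at (x, x) within {(a, b). a \<in> I \<and> b \<in> I \<and> a \<le> x \<and> x \<le> b})"
proof (rule tendstoI)
  fix e :: real assume "e > 0"
  then obtain d where d: "d > 0"
    "\<And>y. y \<in> I \<Longrightarrow> norm (y - x) < d \<Longrightarrow> norm (q y - q x - D * (y - x)) \<le> e / 2 * norm (y - x)"
    using assms(1) unfolding has_field_derivative_def has_derivative_within_alt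
    by (metis half_gt_zero)
  have "dist ((q b - q a) / (b - a)) D < e"
    if ab: "a \<in> I" "b \<in> I" "a \<le> x" "x \<le> b" "(a, b) \<noteq> (x, x)" and dd: "dist (a, b) (x, x) < d" for a b
  proof -
    have "a < b" using ab by force
    have "dist a x < d" "dist b x < d"
      using dd dist_fst_le[of "(a, b)" "(x, x)"] dist_snd_le[of "(a, b)" "(x, x)"] by auto
    then have "\<bar>q a - q x - D * (a - x)\<bar> \<le> e / 2 * (x - a)" "\<bar>q b - q x - D * (b - x)\<bar> \<le> e / 2 * (b - x)"
      using d(2)[of a] d(2)[of b] ab by (auto simp: dist_norm)
    moreover have "(q b - q a) - D * (b - a) = (q b - q x - D * (b - x)) - (q a - q x - D * (a - x))"
      and "e / 2 * (b - a) = e / 2 * (x - a) + e / 2 * (b - x)"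
      by (simp_all add: field_simps)
    ultimately have "\<bar>(q b - q a) - D * (b - a)\<bar> \<le> e / 2 * (b - a)"
      by linarith
    moreover have "(q b - q a) / (b - a) - D = ((q b - q a) - D * (b - a)) / (b - a)"
      using \<open>a < b\<close> by (simp add: field_simps)
    ultimately have "\<bar>(q b - q a) / (b - a) - D\<bar> \<le> e / 2"
      using \<open>a < b\<close> by (simp add: pos_divide_le_eq)
    then show ?thesis using \<open>e > 0\<close> by (simp add: dist_real_def)
  qed
  then show "\<forall>\<^sub>F p in at (x, x) within {(a, b). a \<in> I \<and> b \<in> I \<and> a \<le> x \<and> x \<le> b}.
      dist ((q (snd p) - q (fst p)) / (snd p - fst p)) D < e"
    unfolding eventually_at using d(1) by (intro exI[of _ d]) auto
qed

text \<open>The bound \<open>- e * (b - a)\<close> on increments is additive over adjacent intervals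
  and holds on all short intervals around each point, hence on \<open>{0..R}\<close> by bisection;
  then \<open>e\<close> tends to 0. No derivative of \<open>W\<close> has to exist.\<close>

lemma lower_derivative_nonneg_imp_le:
  fixes W :: "real \<Rightarrow> real"
  assumes "0 \<le> R"
    and loc: "\<And>x e. x \<in> {0..R} \<Longrightarrow> e > 0 \<Longrightarrow>
      \<forall>\<^sub>F p in at (x, x) within {(a, b). a \<in> {0..R} \<and> b \<in> {0..R} \<and> a \<le> x \<and> x \<le> b}.
        W (snd p) - W (fst p) \<ge> - e * (snd p - fst p)"
  shows "W 0 \<le> W R"
proof (rule field_le_epsilon)
  fix e' :: real assume "e' > 0"
  \<comment> \<open>The denominator \<open>R + 1\<close> gives \<open>e * R \<le> e'\<close> and
    stays positive for \<open>R = 0\<close>.\<close>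
  define e where "e = e' / (R + 1)"
  have "e > 0" using \<open>e' > 0\<close> \<open>0 \<le> R\<close> by (simp add: e_def)
  \<comment> \<open>The guard belongs to the predicate bisected by \<open>Bolzano\<close>: short
    intervals around a boundary point may leave \<open>{0..R}\<close>.\<close>
  have "0 \<le> (0::real) \<and> R \<le> R \<longrightarrow> W R - W 0 \<ge> - e * (R - 0)"
  proof (rule Bolzano[of 0 R "\<lambda>a b. 0 \<le> a \<and> b \<le> R \<longrightarrow> W b - W a \<ge> - e * (b - a)"])
    fix x assume x: "0 \<le> x" "x \<le> R"
    let ?S = "{(a, b). a \<in> {0..R} \<and> b \<in> {0..R} \<and> a \<le> x \<and> x \<le> b}"
    obtain d where d: "d > 0" "\<And>p. p \<in> ?S \<Longrightarrow> p \<noteq> (x, x) \<Longrightarrow> dist p (x, x) < d \<Longrightarrow>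
        W (snd p) - W (fst p) \<ge> - e * (snd p - fst p)"
      using loc[of x e] x \<open>e > 0\<close> unfolding eventually_at by (auto simp: Ball_def)
    have "W b - W a \<ge> - e * (b - a)" if "a \<le> x" "x \<le> b" "b - a < d" "0 \<le> a" "b \<le> R" for a b
    proof (cases "(a, b) = (x, x)")
      case False
      have "dist (a, b) (x, x) \<le> \<bar>a - x\<bar> + \<bar>b - x\<bar>"
        using sqrt_sum_squares_le_sum_abs[of "a - x" "b - x"] by (simp add: dist_Pair_Pair dist_real_def)
      then have "dist (a, b) (x, x) < d" using that by linarith
      with d(2)[of "(a, b)"] False that x show ?thesis by auto
    qed auto
    then show "\<exists>d>0. \<forall>a b. a \<le> x \<and> x \<le> b \<and> b - a < d \<longrightarrow> 0 \<le> a \<and> b \<le> R \<longrightarrow> W b - W a \<ge> - e * (b - a)"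
      using d(1) by (intro exI[of _ d]) auto
  qed (use \<open>0 \<le> R\<close> in \<open>auto simp: algebra_simps\<close>)
  then have "W 0 \<le> W R + e * R" by simp
  also have "e * R \<le> e'" using \<open>e' > 0\<close> \<open>0 \<le> R\<close> by (simp add: e_def field_simps)
  finally show "W 0 \<le> W R + e'" by simp
qed

text \<open>Formally the derivative of the monotone quantity is \<open>(s' + q s\<^sup>3)\<^sup>2\<close>. As \<open>s\<close> need not be
  differentiable, the square is expanded on small intervals with the increment bound for the
  constant \<open>c \<approx> q s\<^sup>3\<close>.\<close>
lemma completed_square_monotone:
  fixes s G q J :: "real \<Rightarrow> real"
  assumes "0 \<le> R" and s: "continuous_on {0..R} s"
    and G: "\<And>a b c. 0 \<le> a \<Longrightarrow> a \<le> b \<Longrightarrow> b \<le> R \<Longrightarrow> - (G b - G a + c\<^sup>2 * (b - a)) \<le> 2 * c * (s b - s a)"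
    and q: "\<And>x. x \<in> {0..R} \<Longrightarrow> (q has_real_derivative 2 * (k\<^sup>2 + (q x)\<^sup>2) * (s x)\<^sup>2) (at x within {0..R})"
    and J: "\<And>x. x \<in> {0..R} \<Longrightarrow> (J has_real_derivative s x ^ 6) (at x within {0..R})"
  shows "G 0 + q 0 * s 0 ^ 4 / 2 - k\<^sup>2 * J 0 \<le> G R + q R * s R ^ 4 / 2 - k\<^sup>2 * J R"
proof (rule lower_derivative_nonneg_imp_le[OF \<open>0 \<le> R\<close>, where W = "\<lambda>x. G x + q x * s x ^ 4 / 2 - k\<^sup>2 * J x"])
  fix x e :: real assume x: "x \<in> {0..R}" and "e > 0"
  let ?F = "at (x, x) within {(a, b). a \<in> {0..R} \<and> b \<in> {0..R} \<and> a \<le> x \<and> x \<le> b}"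
  \<comment> \<open>Factoring a difference of fourth powers, this \<open>c\<close> makes
    \<open>q a * (s b ^ 4 - s a ^ 4) / 2\<close> equal to \<open>2 * c p * (s b - s a)\<close>
    exactly, and it tends to \<open>q x * s x ^ 3\<close>.\<close>
  define c where "c p = q (fst p) * ((s (snd p) + s (fst p)) * ((s (snd p))\<^sup>2 + (s (fst p))\<^sup>2)) / 4" for p :: "real \<times> real"
  \<comment> \<open>A lower bound for the increment per unit length: the terms
    \<open>2 * c p * (s b - s a)\<close> cancel against the hypothesis on \<open>G\<close>.\<close>
  define B where "B p = (q (snd p) - q (fst p)) / (snd p - fst p) * s (snd p) ^ 4 / 2 - (c p)\<^sup>2
      - k\<^sup>2 * ((J (snd p) - J (fst p)) / (snd p - fst p))" for p
  have lim: "((\<lambda>p. h (fst p)) \<longlongrightarrow> h x) ?F" "((\<lambda>p. h (snd p)) \<longlongrightarrow> h x) ?F"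
    if "continuous_on {0..R} h" for h :: "real \<Rightarrow> real"
  proof -
    have "continuous_on {(a, b). a \<in> {0..R} \<and> b \<in> {0..R} \<and> a \<le> x \<and> x \<le> b} (\<lambda>p. h (fst p))"
      "continuous_on {(a, b). a \<in> {0..R} \<and> b \<in> {0..R} \<and> a \<le> x \<and> x \<le> b} (\<lambda>p. h (snd p))"
      by (auto intro!: continuous_on_compose2[OF that] continuous_intros)
    then show "((\<lambda>p. h (fst p)) \<longlongrightarrow> h x) ?F" "((\<lambda>p. h (snd p)) \<longlongrightarrow> h x) ?F"
      using x by (auto simp: continuous_on_def)
  qed
  have "continuous_on {0..R} q"
    using q by (meson DERIV_continuous continuous_on_eq_continuous_within)
  note lims = lim[OF this] lim[OF s]
  have climit: "(c \<longlongrightarrow> q x * s x ^ 3) ?F"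
  proof -
    have "(c \<longlongrightarrow> q x * ((s x + s x) * ((s x)\<^sup>2 + (s x)\<^sup>2)) / 4) ?F"
      unfolding c_def by (intro tendsto_intros lims) simp
    then show ?thesis by (simp add: power2_eq_square power3_eq_cube algebra_simps)
  qed
  have "(B \<longlongrightarrow> 2 * (k\<^sup>2 + (q x)\<^sup>2) * (s x)\<^sup>2 * s x ^ 4 / 2 - (q x * s x ^ 3)\<^sup>2 - k\<^sup>2 * s x ^ 6) ?F"
    unfolding B_def
    by (intro tendsto_intros lims climit straddle_quotient_tendsto q J x) simp
  \<comment> \<open>The differential equation for \<open>q\<close> was chosen for this
    cancellation.\<close>
  also have "2 * (k\<^sup>2 + (q x)\<^sup>2) * (s x)\<^sup>2 * s x ^ 4 / 2 - (q x * s x ^ 3)\<^sup>2 - k\<^sup>2 * s x ^ 6 = 0"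
    by (simp add: power_mult_distrib algebra_simps flip: power_mult power_add)
  finally have "\<forall>\<^sub>F p in ?F. B p > - e"
    using \<open>e > 0\<close> by (intro order_tendstoD) auto
  moreover have "\<forall>\<^sub>F p in ?F. p \<in> {(a, b). a \<in> {0..R} \<and> b \<in> {0..R} \<and> a \<le> x \<and> x \<le> b} \<and> p \<noteq> (x, x)"
    by (simp add: eventually_at_filter)
  ultimately show "\<forall>\<^sub>F p in ?F.
        (G (snd p) + q (snd p) * s (snd p) ^ 4 / 2 - k\<^sup>2 * J (snd p)) -
        (G (fst p) + q (fst p) * s (fst p) ^ 4 / 2 - k\<^sup>2 * J (fst p)) \<ge> - e * (snd p - fst p)"
  proof eventually_elim
    case (elim p)
    obtain a b where p: "p = (a, b)" by force
    with elim have ab: "0 \<le> a" "a < b" "b \<le> R" by force+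
    have "- (G b - G a + (c p)\<^sup>2 * (b - a)) \<le> 2 * c p * (s b - s a)"
      using G ab by simp
    moreover have "q b * s b ^ 4 / 2 - q a * s a ^ 4 / 2 = (q b - q a) * s b ^ 4 / 2 + 2 * c p * (s b - s a)"
      by (simp add: c_def p field_simps eval_nat_numeral)
    moreover have "(b - a) * B p = (q b - q a) * s b ^ 4 / 2 - (c p)\<^sup>2 * (b - a) - k\<^sup>2 * (J b - J a)"
      
    proof -
      define X Y where "X = (q b - q a) / (b - a)" and "Y = (J b - J a) / (b - a)"
      have diff: "q b - q a = X * (b - a)" "J b - J a = Y * (b - a)"
        using ab by (simp_all add: X_def Y_def)
      have B: "B p = X * s b ^ 4 / 2 - (c p)\<^sup>2 - k\<^sup>2 * Y"
        by (simp add: B_def p X_def Y_def)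
      show ?thesis
        unfolding diff B by (simp add: field_simps)
    qed
    moreover have "(b - a) * B p \<ge> (b - a) * - e"
      using elim ab by (intro mult_left_mono) auto
    ultimately show ?case
      by (simp add: p algebra_simps)
  qed
qed

text \<open>If \<open>F\<close> stayed above \<open>\<eta>\<close> beyond \<open>R0\<close>, an
  interval of length \<open>(M + 1) / \<eta>\<close> would already carry more than the total
  integral \<open>M\<close>. This removes boundary terms at infinity.\<close>

lemma integrable_half_line_small_value:
  fixes F :: "real \<Rightarrow> real"
  assumes F: "integrable half_line F" "\<And>x. 0 \<le> F x" and "0 \<le> R0" "0 < \<eta>"
  shows "\<exists>R\<ge>R0. F R < \<eta>"
proof (rule ccontr)
  assume "\<not> (\<exists>R\<ge>R0. F R < \<eta>)"
  then have ge: "\<eta> \<le> F x" if "R0 \<le> x" for x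
    using that by (simp add: not_less)
  define M where "M = (LINT x|half_line. F x)"
  define R where "R = R0 + (M + 1) / \<eta>"
  have "0 \<le> M" using F(2) by (simp add: M_def)
  then have "R0 \<le> R" using assms by (simp add: R_def)
  have "integral {R0..R} (\<lambda>_. \<eta>) \<le> integral {R0..R} F"
    using ge half_line_integrable_on[OF F \<open>0 \<le> R0\<close>] set_lebesgue_integral_eq_integral(1)
    by (intro integral_le) auto
  then have "M + 1 \<le> integral {R0..R} F"
    using \<open>R0 \<le> R\<close> \<open>0 < \<eta>\<close> by (simp add: R_def)
  also have "\<dots> \<le> M"
    unfolding M_def using assms by (intro integral_le_half_line) auto
  finally show False by simp
qed

section \<open>Trace and Gagliardo-Nirenberg bounds on one edge\<close>

lemma H1_halfD:
  assumes "f \<in> H1_half"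
  shows "integrable half_line (\<lambda>x. (norm (f x))\<^sup>2)" "continuous_on {0..} f"
  using assms Lp_space_2D by (auto simp: H1_half_def)

lemma has_L2_weak_deriv_integrable:
  "has_L2_weak_deriv f g \<Longrightarrow> integrable half_line (\<lambda>x. (norm (g x))\<^sup>2)"
  using Lp_space_2D unfolding has_L2_weak_deriv_def by auto

text \<open>Somewhere on \<open>{0..L}\<close> the squared modulus is at most its mean, and the
  increment bound carries this to the vertex. A small \<open>L\<close> makes the derivative term
  cheap.\<close>

lemma H1_half_trace_bound:
  assumes f: "f \<in> H1_half" and g: "has_L2_weak_deriv f g" and L: "0 < L"
  shows "(norm (f 0))\<^sup>2 \<le> 2 / L * (LINT x|half_line. (norm (f x))\<^sup>2) + 2 * L * (LINT x|half_line. (norm (g x))\<^sup>2)"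
proof -
  define M X where "M = (LINT x|half_line. (norm (f x))\<^sup>2)" and "X = (LINT x|half_line. (norm (g x))\<^sup>2)"
  have cont: "continuous_on {0..L} (\<lambda>x. (norm (f x))\<^sup>2)"
    by (intro continuous_intros continuous_on_subset[OF H1_halfD(2)[OF f]]) auto
  then obtain x where x: "x \<in> {0..L}" and min: "\<And>y. y \<in> {0..L} \<Longrightarrow> (norm (f x))\<^sup>2 \<le> (norm (f y))\<^sup>2"
    using continuous_attains_inf[of "{0..L}" "\<lambda>x. (norm (f x))\<^sup>2"] L by (auto simp del: power_mono_iff)
  have "integral {0..L} (\<lambda>_. (norm (f x))\<^sup>2) \<le> integral {0..L} (\<lambda>y. (norm (f y))\<^sup>2)"
    using min cont by (intro integral_le integrable_continuous_interval) auto
  also have "\<dots> \<le> M"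
    unfolding M_def by (rule integral_le_half_line) (use H1_halfD f in auto)
  finally have 1: "(norm (f x))\<^sup>2 \<le> M / L" using L by (simp add: field_simps)
  define \<Delta> where "\<Delta> = norm (f x - f 0)"
  \<comment> \<open>With \<open>c = \<Delta> / L\<close>, half of the left side absorbs the
    \<open>c\<^sup>2\<close> term.\<close>
  have "2 * (\<Delta> / L) * \<Delta> \<le> integral {0..x} (\<lambda>x. (norm (g x))\<^sup>2) + (\<Delta> / L)\<^sup>2 * (x - 0)"
    unfolding \<Delta>_def using x L f g by (intro H1_increment H1_halfD) auto
  also have "integral {0..x} (\<lambda>x. (norm (g x))\<^sup>2) \<le> X"
    unfolding X_def by (rule integral_le_half_line) (use has_L2_weak_deriv_integrable g in auto)
  also have "(\<Delta> / L)\<^sup>2 * (x - 0) \<le> (\<Delta> / L)\<^sup>2 * L"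
    using x by (intro mult_left_mono) auto
  also have "(\<Delta> / L)\<^sup>2 * L = \<Delta>\<^sup>2 / L"
    using L by (simp add: field_simps power2_eq_square)
  finally have 2: "\<Delta>\<^sup>2 \<le> L * X"
    using L by (simp add: field_simps power2_eq_square)
  have "norm (f 0) \<le> norm (f x) + \<Delta>"
    unfolding \<Delta>_def by (metis norm_minus_commute norm_triangle_sub)
  then have "(norm (f 0))\<^sup>2 \<le> (norm (f x) + \<Delta>)\<^sup>2"
    by (intro power_mono) auto
  also have "\<dots> \<le> 2 * (norm (f x))\<^sup>2 + 2 * \<Delta>\<^sup>2"
    using sum_squares_bound[of "norm (f x)" \<Delta>] by (simp add: power2_sum)
  also have "\<dots> \<le> 2 * (M / L) + 2 * (L * X)"
    using 1 2 by linarith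
  finally show ?thesis by (simp add: M_def X_def)
qed

text \<open>The weight \<open>q\<close> is the solution of \<open>q' = 2 (k\<^sup>2 + q\<^sup>2) \<bar>f\<bar>\<^sup>2\<close>, a cotangent in the variable
  \<open>\<integral>\<^sub>x\<^sup>\<infinity> \<bar>f\<bar>\<^sup>2\<close>; the shift \<open>\<epsilon>\<close> keeps it finite at infinity.\<close>
lemma half_line_gagliardo_nirenberg:
  assumes f: "f \<in> H1_half" and g: "has_L2_weak_deriv f g" and k: "0 < k" and \<epsilon>: "0 < \<epsilon>"
    and less_pi: "2 * k * (LINT x|half_line. (norm (f x))\<^sup>2) + \<epsilon> < pi"
  shows "k\<^sup>2 * (LINT x|half_line. norm (f x) ^ 6)
      + k / 2 * cot (2 * k * (LINT x|half_line. (norm (f x))\<^sup>2) + \<epsilon>) * norm (f 0) ^ 4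
    \<le> (LINT x|half_line. (norm (g x))\<^sup>2)"
proof -
  define M X where "M = (LINT x|half_line. (norm (f x))\<^sup>2)" and "X = (LINT x|half_line. (norm (g x))\<^sup>2)"
  define s where "s x = norm (f x)" for x
  define S where "S x = integral {0..x} (\<lambda>x. (s x)\<^sup>2)" for x
  define J where "J x = integral {0..x} (\<lambda>x. s x ^ 6)" for x
  define G where "G x = integral {0..x} (\<lambda>x. (norm (g x))\<^sup>2)" for x
  \<comment> \<open>The angle stays in \<open>{\<epsilon>..2 * k * M + \<epsilon>}\<close>, inside
    the open interval from 0 to \<open>pi\<close>, where the cotangent is smooth.\<close>
  define \<theta> where "\<theta> x = 2 * k * (M - S x) + \<epsilon>" for x
  define q where "q x = k * cot (\<theta> x)" for x
  note f' = H1_halfD[OF f] and g' = has_L2_weak_deriv_integrable[OF g]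
  have scont: "continuous_on {0..} s"
    unfolding s_def by (intro continuous_intros f')
  have gint: "(\<lambda>x. (norm (g x))\<^sup>2) integrable_on {a..b}" if "0 \<le> a" for a b
    using half_line_integrable_on[OF g'] that set_lebesgue_integral_eq_integral(1) by auto
  have S_bounds: "0 \<le> S x" "S x \<le> M" for x
  proof -
    show "0 \<le> S x" unfolding S_def by (rule Henstock_Kurzweil_Integration.integral_nonneg)
      (auto intro!: integrable_continuous_interval continuous_intros continuous_on_subset[OF scont])
    show "S x \<le> M"
      unfolding S_def s_def M_def by (rule integral_le_half_line) (use f' in auto)
  qed
  have \<theta>_bounds: "\<epsilon> \<le> \<theta> x" "\<theta> x \<le> 2 * k * M + \<epsilon>" for x
    using S_bounds[of x] k by (auto simp: \<theta>_def)
  have sin_pos: "0 < sin t" if "\<epsilon> \<le> t" "t \<le> 2 * k * M + \<epsilon>" for t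
    using that \<epsilon> less_pi by (intro sin_gt_zero) (auto simp: M_def)
  have deriv: "(q has_real_derivative 2 * (k\<^sup>2 + (q x)\<^sup>2) * (s x)\<^sup>2) (at x within {0..R})"
    if "x \<in> {0..R}" for x R
  proof -
    have "(S has_real_derivative (s x)\<^sup>2) (at x within {0..R})"
      unfolding S_def by (rule integral_has_real_derivative)
        (use that in \<open>auto intro!: continuous_intros continuous_on_subset[OF scont]\<close>)
    then have "(\<theta> has_real_derivative 2 * k * (0 - (s x)\<^sup>2) + 0) (at x within {0..R})"
      unfolding \<theta>_def by (intro DERIV_add DERIV_cmult DERIV_diff DERIV_const)
    moreover have "sin (\<theta> x) \<noteq> 0"
      using sin_pos[OF \<theta>_bounds, of x] by simp
    ultimately have "((\<lambda>x. k * cot (\<theta> x)) has_real_derivative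
        k * (- inverse ((sin (\<theta> x))\<^sup>2) * (2 * k * (0 - (s x)\<^sup>2) + 0))) (at x within {0..R})"
      by (intro DERIV_cmult DERIV_chain2[OF DERIV_cot])
    then
    have "(q has_real_derivative k * (- inverse ((sin (\<theta> x))\<^sup>2) * (2 * k * (0 - (s x)\<^sup>2) + 0))) (at x within {0..R})"
      unfolding q_def .
    moreover have "k * (- inverse ((sin (\<theta> x))\<^sup>2) * (2 * k * (0 - (s x)\<^sup>2) + 0)) = 2 * (k\<^sup>2 + (q x)\<^sup>2) * (s x)\<^sup>2"
    proof -
      have "k\<^sup>2 + (q x)\<^sup>2 = k\<^sup>2 * (((sin (\<theta> x))\<^sup>2 + (cos (\<theta> x))\<^sup>2) * inverse ((sin (\<theta> x))\<^sup>2))"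
        using sin_pos[OF \<theta>_bounds, of x]
        by (simp add: q_def cot_def field_simps power2_eq_square del: sin_cos_squared_add sin_cos_squared_add2 sin_cos_squared_add3)
      then show ?thesis by (simp add: power2_eq_square algebra_simps)
    qed
    ultimately show ?thesis by (simp only:)
  qed
  have monotone: "k\<^sup>2 * J R + q 0 * s 0 ^ 4 / 2 \<le> X + q R * s R ^ 4 / 2" if "0 \<le> R" for R
  proof -
    have "G 0 + q 0 * s 0 ^ 4 / 2 - k\<^sup>2 * J 0 \<le> G R + q R * s R ^ 4 / 2 - k\<^sup>2 * J R"
    proof (rule completed_square_monotone[OF that _ _ deriv])
      show "continuous_on {0..R} s"
        by (rule continuous_on_subset[OF scont]) auto
      fix a b c :: real assume ab: "0 \<le> a" "a \<le> b" "b \<le> R"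
      have "\<bar>2 * c * (s b - s a)\<bar> \<le> 2 * \<bar>c\<bar> * norm (f b - f a)"
        unfolding s_def using norm_triangle_ineq3[of "f b" "f a"] by (simp add: abs_mult mult_left_mono)
      also have "\<dots> \<le> integral {a..b} (\<lambda>x. (norm (g x))\<^sup>2) + \<bar>c\<bar>\<^sup>2 * (b - a)"
        using ab by (intro H1_increment f' g) auto
      also have "integral {a..b} (\<lambda>x. (norm (g x))\<^sup>2) = G b - G a"
        unfolding G_def
        using Henstock_Kurzweil_Integration.integral_combine[OF ab(1,2) gint] by simp
      finally show "- (G b - G a + c\<^sup>2 * (b - a)) \<le> 2 * c * (s b - s a)"
        by simp
    next
      fix x assume "x \<in> {0..R}"
      then show "(J has_real_derivative s x ^ 6) (at x within {0..R})"
        unfolding J_def by (intro integral_has_real_derivative)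
          (auto intro!: continuous_intros continuous_on_subset[OF scont])
    qed
    moreover have "G 0 = 0" "J 0 = 0" by (simp_all add: G_def J_def)
    moreover have "G R \<le> X"
      unfolding G_def X_def by (rule integral_le_half_line) (use g' in auto)
    ultimately show ?thesis by simp
  qed
  \<comment> \<open>As \<open>\<epsilon> > 0\<close>, the weight is bounded by a constant
    \<open>C\<close> independent of \<open>R\<close>.\<close>
  have "continuous_on {\<epsilon>..2 * k * M + \<epsilon>} (\<lambda>t. k * cot t)"
    using sin_pos by (intro continuous_intros) (auto simp: less_imp_neq[symmetric])
  then have "compact ((\<lambda>t. k * cot t) ` {\<epsilon>..2 * k * M + \<epsilon>})"
    by (rule compact_continuous_image) simp
  then obtain C where C: "C > 0" "\<And>t. t \<in> {\<epsilon>..2 * k * M + \<epsilon>} \<Longrightarrow> \<bar>k * cot t\<bar> \<le> C"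
    using compact_imp_bounded bounded_pos by (metis imageI real_norm_def)
  have "k\<^sup>2 * J R0 + q 0 * s 0 ^ 4 / 2 \<le> X" if R0: "0 \<le> R0" for R0
  proof (rule field_le_epsilon)
    fix e :: real assume "e > 0"
    \<comment> \<open>Far out there is a point where \<open>C * s R ^ 4 \<le> e\<close>, which
      disposes of the boundary term; monotonicity of \<open>J\<close> leads back to
      \<open>R0\<close>.\<close>
    obtain R where R: "R0 \<le> R" "(s R)\<^sup>2 < sqrt (e / C)"
      using integrable_half_line_small_value[OF f'(1) _ R0, of "sqrt (e / C)"] \<open>e > 0\<close> C(1)
      by (auto simp: s_def)
    have "s R ^ 4 = ((s R)\<^sup>2)\<^sup>2" by simp
    also have "\<dots> \<le> (sqrt (e / C))\<^sup>2"
      using R(2) by (intro power_mono) auto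
    also have "\<dots> = e / C"
      using \<open>e > 0\<close> C(1) by simp
    finally have "C * s R ^ 4 \<le> e"
      using C(1) by (simp add: field_simps)
    moreover have "q R * s R ^ 4 \<le> C * s R ^ 4"
      using C(2)[of "\<theta> R"] \<theta>_bounds[of R] unfolding q_def s_def
      by (intro mult_right_mono) auto
    moreover have "k\<^sup>2 * J R0 \<le> k\<^sup>2 * J R"
      unfolding J_def using R(1)
      by (intro mult_left_mono integral_subset_le integrable_continuous_interval)
        (auto simp: s_def intro!: continuous_intros continuous_on_subset[OF f'(2)])
    ultimately show "k\<^sup>2 * J R0 + q 0 * s 0 ^ 4 / 2 \<le> X + e"
      using monotone[of R] R(1) R0 \<open>e > 0\<close> by simp
  qed
  then have "J R0 \<le> (X - q 0 * s 0 ^ 4 / 2) / k\<^sup>2" if "0 \<le> R0" for R0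
    using k that by (simp add: field_simps)
  then have "(LINT x|half_line. s x ^ 6) \<le> (X - q 0 * s 0 ^ 4 / 2) / k\<^sup>2"
    unfolding J_def by (rule half_line_integral_le_bound)
  then have "k\<^sup>2 * (LINT x|half_line. s x ^ 6) + q 0 * s 0 ^ 4 / 2 \<le> X"
    using k by (simp add: field_simps)
  moreover have "q 0 = k * cot (2 * k * M + \<epsilon>)"
    by (simp add: q_def \<theta>_def S_def)
  ultimately show ?thesis
    by (simp add: M_def X_def s_def)
qed

section \<open>Signs of sums of cotangents\<close>

lemma cot_nonneg: "0 < t \<Longrightarrow> t \<le> pi / 2 \<Longrightarrow> 0 \<le> cot (t::real)"
  unfolding cot_def by (intro divide_nonneg_nonneg cos_ge_zero sin_ge_zero) auto

text \<open>By the addition formula the sum is \<open>sin (a + b) / (sin a * sin b)\<close>.\<close>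

lemma cot_add_cot_nonneg:
  fixes a b :: real
  assumes "0 < a" "0 < b" "a + b \<le> pi"
  shows "0 \<le> cot a + cot b"
proof -
  have "0 < sin a" "0 < sin b" using assms by (auto intro!: sin_gt_zero)
  then have "cot a + cot b = sin (a + b) / (sin a * sin b)"
    by (simp add: cot_def sin_add field_simps)
  also have "\<dots> \<ge> 0"
    using assms \<open>0 < sin a\<close> \<open>0 < sin b\<close> by (intro divide_nonneg_nonneg sin_ge_zero) auto
  finally show ?thesis .
qed

text \<open>At most one angle exceeds \<open>pi / 2\<close>. Its negative cotangent is compensated
  by any one partner, since the two angles add up to at most \<open>pi\<close>; the remaining
  cotangents are nonnegative.\<close>

lemma sum_cot_nonneg:
  fixes \<beta> :: "'a \<Rightarrow> real"
  assumes A: "finite A" "2 \<le> card A" and pos: "\<And>j. j \<in> A \<Longrightarrow> 0 < \<beta> j" and le: "(\<Sum>j\<in>A. \<beta> j) \<le> pi"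
  shows "0 \<le> (\<Sum>j\<in>A. cot (\<beta> j))"
proof (cases "\<exists>i\<in>A. pi / 2 < \<beta> i")
  case False
  then show ?thesis using pos by (intro sum_nonneg cot_nonneg) (auto simp: not_less)
next
  case True
  then obtain i where i: "i \<in> A" "pi / 2 < \<beta> i" by auto
  \<comment> \<open>The cardinality assumption supplies the partner.\<close>
  have "A - {i} \<noteq> {}"
    using A i by (metis card.empty card_Suc_Diff1 not_less_eq_eq numeral_2_eq_2 order_refl)
  then obtain l where l: "l \<in> A - {i}" by auto
  have pair: "\<beta> i + \<beta> r \<le> pi" if "r \<in> A - {i}" for r
  proof -
    have "\<beta> i + \<beta> r = (\<Sum>j\<in>{i, r}. \<beta> j)" using that by auto
    also have "\<dots> \<le> (\<Sum>j\<in>A. \<beta> j)"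
      using that i A pos by (intro sum_mono2) (auto simp: less_imp_le)
    finally show ?thesis using le by simp
  qed
  have "(\<Sum>j\<in>A. cot (\<beta> j)) = cot (\<beta> i) + (cot (\<beta> l) + (\<Sum>j\<in>A - {i} - {l}. cot (\<beta> j)))"
    using A i l by (simp add: sum.remove)
  moreover have "0 \<le> (\<Sum>j\<in>A - {i} - {l}. cot (\<beta> j))"
    using pair i pos by (intro sum_nonneg cot_nonneg) fastforce+
  moreover have "0 \<le> cot (\<beta> i) + cot (\<beta> l)"
    using pair l i pos by (intro cot_add_cot_nonneg) auto
  ultimately show ?thesis by linarith
qed

section \<open>The sharp inequality on the star graph\<close>

lemma Lp_norm_powr: "0 < p \<Longrightarrow> Lp_norm M p f powr p = (LINT x|M. norm (f x) powr p)"
  by (simp add: Lp_norm_def powr_powr)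

lemma Lp_norm_2_power2: "(Lp_norm M 2 f)\<^sup>2 = (LINT x|M. (norm (f x))\<^sup>2)"
  using Lp_norm_powr[of 2 M f] by (simp add: powr_numeral Lp_norm_def)

text \<open>Numeral exponents make the powers 2 and 6 instances of one formula.\<close>

lemma graph_Lp_norm_power:
  "graph_Lp_norm N (numeral n) u ^ numeral n = (\<Sum>j\<in>{1..N}. LINT x|half_line. norm (u j x) ^ numeral n)"
proof -
  have eq: "(\<Sum>j\<in>{1..N}. Lp_norm half_line (numeral n) (u j) powr numeral n) =
      (\<Sum>j\<in>{1..N}. LINT x|half_line. norm (u j x) ^ numeral n)"
    by (simp add: Lp_norm_powr powr_numeral)
  have "0 \<le> (\<Sum>j\<in>{1..N}. LINT x|half_line. norm (u j x) ^ numeral n)"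
    by (intro sum_nonneg Bochner_Integration.integral_nonneg) auto
  then have "((\<Sum>j\<in>{1..N}. LINT x|half_line. norm (u j x) ^ numeral n) powr (1 / numeral n)) powr numeral n
      = (\<Sum>j\<in>{1..N}. LINT x|half_line. norm (u j x) ^ numeral n)"
    by (simp add: powr_powr)
  then show ?thesis
    unfolding graph_Lp_norm_def eq by (simp add: powr_numeral)
qed

lemma H1_norm_eq:
  "H1_norm N u = sqrt ((graph_Lp_norm N 2 u)\<^sup>2 + (graph_Lp_norm N 2 (graph_deriv u))\<^sup>2)"
  unfolding H1_norm_def H1_half_norm_def graph_Lp_norm_power graph_deriv_def
  by (simp add: Lp_norm_2_power2 sum.distrib)

lemma weak_deriv_H1_half: "f \<in> H1_half \<Longrightarrow> has_L2_weak_deriv f (weak_deriv f)"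
  using someI_ex[of "has_L2_weak_deriv f"] by (auto simp: H1_half_def weak_deriv_def)

lemma H1_D_edge:
  assumes "u \<in> H1_D N" "j \<in> {1..N}"
  shows "u j \<in> H1_half" "u j 0 = vertex_value u"
proof -
  have edges: "\<forall>j\<in>{1..N}. u j \<in> H1_half" "\<forall>j\<in>{1..N}. \<forall>k\<in>{1..N}. u j 0 = u k 0"
    using assms(1) unfolding H1_D_def H1_def by blast+
  have "1 \<in> {1..N}" using assms(2) by simp
  then show "u j \<in> H1_half" "u j 0 = vertex_value u"
    using edges assms(2) unfolding vertex_value_def by blast+
qed

text \<open>The trace bound on the first edge, whose share of each norm is at most the
  total.\<close>

lemma star_graph_vertex_bound:
  assumes u: "u \<in> H1_D N" and "N \<ge> 1" and L: "0 < L"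
  shows "(norm (vertex_value u))\<^sup>2 \<le> 2 / L * (graph_Lp_norm N 2 u)\<^sup>2 + 2 * L * (graph_Lp_norm N 2 (graph_deriv u))\<^sup>2"
proof -
  have 1: "(1::nat) \<in> {1..N}" using \<open>N \<ge> 1\<close> by simp
  note e = H1_D_edge[OF u 1]
  have "(LINT x|half_line. (norm (w 1 x))\<^sup>2) \<le> (graph_Lp_norm N 2 w)\<^sup>2" for w
    unfolding graph_Lp_norm_power using 1 by (intro member_le_sum) auto
  then have "2 / L * (LINT x|half_line. (norm (u 1 x))\<^sup>2) + 2 * L * (LINT x|half_line. (norm (graph_deriv u 1 x))\<^sup>2)
      \<le> 2 / L * (graph_Lp_norm N 2 u)\<^sup>2 + 2 * L * (graph_Lp_norm N 2 (graph_deriv u))\<^sup>2"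
    using L by (intro add_mono mult_left_mono) auto
  then show ?thesis
    using H1_half_trace_bound[OF e(1) weak_deriv_H1_half[OF e(1)] L] e(2) by (simp add: graph_deriv_def)
qed

text \<open>In the sum over the edges, the common vertex value factors out of the boundary terms, so
  only the total of the cotangents matters.\<close>

lemma star_graph_gagliardo_nirenberg_cot:
  assumes u: "u \<in> H1_D N" and k: "0 < k" and \<epsilon>: "0 < \<epsilon>"
    and less_pi: "\<And>j. j \<in> {1..N} \<Longrightarrow> 2 * k * (LINT x|half_line. (norm (u j x))\<^sup>2) + \<epsilon> < pi"
    and cot: "0 \<le> (\<Sum>j\<in>{1..N}. cot (2 * k * (LINT x|half_line. (norm (u j x))\<^sup>2) + \<epsilon>))"
  shows "k\<^sup>2 * graph_Lp_norm N 6 u ^ 6 \<le> (graph_Lp_norm N 2 (graph_deriv u))\<^sup>2"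
proof -
  let ?c = "\<lambda>j. cot (2 * k * (LINT x|half_line. (norm (u j x))\<^sup>2) + \<epsilon>)"
  have "(\<Sum>j\<in>{1..N}. k\<^sup>2 * (LINT x|half_line. norm (u j x) ^ 6) + k / 2 * ?c j * norm (vertex_value u) ^ 4)
      \<le> (\<Sum>j\<in>{1..N}. LINT x|half_line. (norm (graph_deriv u j x))\<^sup>2)"
    using half_line_gagliardo_nirenberg[OF H1_D_edge(1)[OF u] weak_deriv_H1_half[OF H1_D_edge(1)[OF u]] k \<epsilon> less_pi]
    by (intro sum_mono) (simp add: H1_D_edge(2)[OF u] graph_deriv_def)
  then have "k\<^sup>2 * graph_Lp_norm N 6 u ^ 6 + k / 2 * (\<Sum>j\<in>{1..N}. ?c j) * norm (vertex_value u) ^ 4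
      \<le> (graph_Lp_norm N 2 (graph_deriv u))\<^sup>2"
    unfolding graph_Lp_norm_power by (simp only: sum.distrib sum_distrib_left sum_distrib_right)
  moreover have "0 \<le> k / 2 * (\<Sum>j\<in>{1..N}. ?c j) * norm (vertex_value u) ^ 4"
    using k cot by simp
  ultimately show ?thesis by linarith
qed

text \<open>Here \<open>c\<close> is the mass threshold in units of the squared norm of
  \<open>Q\<close>: for \<open>k = 1 / sqrt 3\<close> the last hypothesis says that the mass is
  below \<open>c * (sqrt 3 * pi / 2)\<close>. The slack in it is spent on the shift
  \<open>\<epsilon>\<close>.\<close>

lemma star_graph_gagliardo_nirenberg:
  assumes u: "u \<in> H1_D N" and "N \<ge> 1" and k: "0 < k"
    and c: "c \<le> real N / 2" "radial N u \<or> c \<le> 1"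
    and less: "2 * k * (graph_Lp_norm N 2 u)\<^sup>2 < c * pi"
  shows "k\<^sup>2 * graph_Lp_norm N 6 u ^ 6 \<le> (graph_Lp_norm N 2 (graph_deriv u))\<^sup>2"
proof -
  define m where "m = (graph_Lp_norm N 2 u)\<^sup>2"
  define M where "M j = (LINT x|half_line. (norm (u j x))\<^sup>2)" for j
  have m: "m = (\<Sum>j\<in>{1..N}. M j)"
    by (simp add: m_def M_def graph_Lp_norm_power)
  have M_nonneg: "0 \<le> M j" for j by (simp add: M_def)
  have "c * pi \<le> real N / 2 * pi" using c by (intro mult_right_mono) auto
  then have less_N: "2 * k * m < real N / 2 * pi" using less unfolding m_def by linarith
  show ?thesis
  proof (cases "radial N u")
    case True
    have M_eq: "M j = M 1" if j: "j \<in> {1..N}" for j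
    proof -
      have "u j x = u 1 x" if "0 \<le> x" for x
        using True[unfolded radial_def, rule_format, of j 1 x] that j \<open>N \<ge> 1\<close> by simp
      then show ?thesis
        unfolding M_def by (intro Bochner_Integration.integral_cong) auto
    qed
    have "m = (\<Sum>j\<in>{1..N}. M 1)"
      unfolding m by (rule sum.cong[OF refl M_eq])
    then have "m = real N * M 1" by simp
    then have Mj: "M j = m / real N" if "j \<in> {1..N}" for j
      using M_eq[OF that] \<open>m = real N * M 1\<close> \<open>N \<ge> 1\<close> by simp
    \<comment> \<open>All edges carry the same mass, so this shift puts every angle at exactly
      \<open>pi / 2\<close>.\<close>
    define \<epsilon> where "\<epsilon> = pi / 2 - 2 * k * (m / real N)"
    have "0 < \<epsilon>" using less_N \<open>N \<ge> 1\<close> by (simp add: \<epsilon>_def field_simps)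
    then have \<beta>: "2 * k * M j + \<epsilon> = pi / 2" if "j \<in> {1..N}" for j
      using Mj[OF that] by (simp add: \<epsilon>_def)
    show ?thesis
    proof (rule star_graph_gagliardo_nirenberg_cot[OF u k \<open>0 < \<epsilon>\<close>], unfold M_def[symmetric])
      show "0 \<le> (\<Sum>j\<in>{1..N}. cot (2 * k * M j + \<epsilon>))"
        by (intro sum_nonneg cot_nonneg) (simp_all add: \<beta>)
    qed (simp add: \<beta>)
  next
    case False
    \<comment> \<open>On a single edge every function is radial.\<close>
    then have "N \<noteq> 1" by (auto simp: radial_def)
    then have "N \<ge> 2" using \<open>N \<ge> 1\<close> by simp
    have "c * pi \<le> 1 * pi" using False c by (intro mult_right_mono) auto
    then have less_pi: "2 * k * m < pi" using less unfolding m_def by linarith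
    \<comment> \<open>Sharing the slack equally makes the angles add up to \<open>pi\<close>. With
      two or more edges, one share still leaves each single angle strictly below
      \<open>pi\<close>.\<close>
    define \<epsilon> where "\<epsilon> = (pi - 2 * k * m) / real N"
    have \<epsilon>: "0 < \<epsilon>" using less_pi \<open>N \<ge> 1\<close> by (simp add: \<epsilon>_def)
    have "2 * \<epsilon> \<le> real N * \<epsilon>" using \<open>N \<ge> 2\<close> \<epsilon> by (intro mult_right_mono) auto
    then have "2 * \<epsilon> \<le> pi - 2 * k * m" using \<open>N \<ge> 1\<close> by (simp add: \<epsilon>_def)
    show ?thesis
    proof (rule star_graph_gagliardo_nirenberg_cot[OF u k \<epsilon>], unfold M_def[symmetric])
      fix j assume "j \<in> {1..N}"
      then have "M j \<le> m" unfolding m using M_nonneg by (intro member_le_sum) auto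
      then have "2 * k * M j \<le> 2 * k * m" using k by simp
      then show "2 * k * M j + \<epsilon> < pi" using \<epsilon> \<open>2 * \<epsilon> \<le> pi - 2 * k * m\<close> by linarith
    next
      have "(\<Sum>j\<in>{1..N}. 2 * k * M j + \<epsilon>) = 2 * k * m + real N * \<epsilon>"
        by (simp add: sum.distrib m sum_distrib_left)
      also have "\<dots> = pi" using \<open>N \<ge> 1\<close> by (simp add: \<epsilon>_def)
      finally show "0 \<le> (\<Sum>j\<in>{1..N}. cot (2 * k * M j + \<epsilon>))"
        using \<open>N \<ge> 2\<close> \<epsilon> k M_nonneg by (intro sum_cot_nonneg) (auto intro!: add_nonneg_pos)
    qed
  qed
qed

text \<open>The square of \<open>Q\<close> is \<open>sqrt 3 / cosh (2 * x)\<close>, with primitive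
  \<open>sqrt 3 / 2 * arctan (sinh (2 * x))\<close>.\<close>

lemma Q_norm: "(Lp_norm lebesgue 2 Q)\<^sup>2 = sqrt 3 * pi / 2"
proof -
  have Q2: "(norm (Q x))\<^sup>2 = sqrt 3 / cosh (2 * x)" for x
  proof -
    have "((3::real) powr (1/4))\<^sup>2 = sqrt 3"
      by (simp add: powr_half_sqrt[symmetric] power2_eq_square flip: powr_add)
    moreover have "(cosh (2 * x) powr (-1/2))\<^sup>2 = inverse (cosh (2 * x))"
    proof -
      have "(cosh (2 * x) powr (-1/2))\<^sup>2 = cosh (2 * x) powr (-1/2 + -1/2)"
        unfolding power2_eq_square powr_add ..
      also have "\<dots> = inverse (cosh (2 * x))"
        by (simp add: powr_minus less_imp_le)
      finally show ?thesis .
    qed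
    moreover have "(norm (Q x))\<^sup>2 = (3 powr (1/4))\<^sup>2 * (cosh (2 * x) powr (-1/2))\<^sup>2"
      unfolding Q_def by (simp only: power_mult_distrib real_norm_def power2_abs)
    ultimately show ?thesis by (simp only: divide_inverse)
  qed
  let ?f = "\<lambda>x::real. sqrt 3 / cosh (2 * x)" and ?F = "\<lambda>x::real. sqrt 3 / 2 * arctan (sinh (2 * x))"
  have pos: "0 < cosh (2 * x)" for x :: real by (rule cosh_real_pos)
  have cont: "isCont ?f x" for x
    using pos[of x] by (intro continuous_intros) (auto simp: less_imp_neq[symmetric])
  have top: "(?F \<longlongrightarrow> sqrt 3 / 2 * (pi / 2)) at_top"
    by (intro tendsto_intros filterlim_compose[OF tendsto_arctan_at_top]
        filterlim_compose[OF sinh_real_at_top] filterlim_tendsto_pos_mult_at_top[OF tendsto_const] filterlim_ident) auto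
  have bot: "(?F \<longlongrightarrow> sqrt 3 / 2 * (- (pi / 2))) at_bot"
    by (intro tendsto_intros filterlim_compose[OF tendsto_arctan_at_bot]
        filterlim_compose[OF sinh_real_at_bot] filterlim_tendsto_pos_mult_at_bot[OF tendsto_const] filterlim_ident) auto
  have deriv: "DERIV ?F x :> ?f x" for x
  proof -
    have "DERIV ?F x :> sqrt 3 / 2 * (inverse (1 + (sinh (2 * x))\<^sup>2) * (cosh (2 * x) * 2))"
      by (rule derivative_eq_intros refl | simp)+
    also have "1 + (sinh (2 * x))\<^sup>2 = (cosh (2 * x))\<^sup>2"
      by (simp add: cosh_square_eq)
    also have "sqrt 3 / 2 * (inverse ((cosh (2 * x))\<^sup>2) * (cosh (2 * x) * 2)) = ?f x"
      using pos[of x] by (simp add: field_simps power2_eq_square)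
    finally show ?thesis .
  qed
  have "(LBINT x=-\<infinity>..\<infinity>. ?f x) = sqrt 3 / 2 * (pi / 2) - sqrt 3 / 2 * (- (pi / 2))"
    by (rule interval_integral_FTC_nonneg(2)[where F = ?F])
      (use deriv cont pos top bot in \<open>auto simp: ereal_tendsto_simps less_imp_le\<close>)
  then have "(LINT x|lborel. ?f x) = sqrt 3 * pi / 2"
    by (simp add: interval_lebesgue_integral_def set_lebesgue_integral_def)
  moreover have "?f \<in> borel_measurable lborel"
    using cont by (simp add: borel_measurable_continuous_onI continuous_at_imp_continuous_on)
  ultimately show ?thesis
    unfolding Lp_norm_2_power2 Q2 by (simp add: integral_completion)
qed

section \<open>Bounds from the conserved quantities\<close>

text \<open>Strictly below the threshold some \<open>k > 1 / sqrt 3\<close> is admissible. The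
  sextic term then costs less than the whole kinetic energy, and the vertex term, of either sign, is
  absorbed by the trace bound. The result depends only on conserved quantities, hence is uniform in
  time.\<close>

lemma subcritical_H1_bound:
  assumes "N \<ge> 1" and c: "c \<le> real N / 2" and m: "0 \<le> m" "m < c * (Lp_norm lebesgue 2 Q)\<^sup>2"
  shows "\<exists>B. \<forall>v\<in>H1_D N. (radial N v \<or> c \<le> 1) \<and> (graph_Lp_norm N 2 v)\<^sup>2 = m \<and> energy N \<gamma> v = E
    \<longrightarrow> H1_norm N v \<le> B"
proof -
  \<comment> \<open>The slack at \<open>k = 1 / sqrt 3\<close>.\<close>
  define D where "D = c * pi - 2 * m / sqrt 3"
  \<comment> \<open>The increase of \<open>k\<close> raises \<open>2 * k * m\<close> by less than
    \<open>D\<close>; the summand 1 also covers \<open>m = 0\<close>.\<close>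
  define k where "k = 1 / sqrt 3 + D / (2 * (2 * m + 1))"
  \<comment> \<open>The fraction of the squared derivative norm that survives the sextic
    term.\<close>
  define \<delta> where "\<delta> = 1 / 2 - 1 / (6 * k\<^sup>2)"
  \<comment> \<open>Chosen so that \<open>\<bar>\<gamma>\<bar> * L \<le> \<delta> / 2\<close>: half
    of the surviving fraction pays for the vertex term.\<close>
  define L where "L = \<delta> / (2 * (\<bar>\<gamma>\<bar> + 1))"
  define B where "B = 2 / \<delta> * (E + \<bar>\<gamma>\<bar> / L * m)"
  have D: "0 < D"
  proof -
    have "m < c * (sqrt 3 * pi / 2)" using m(2) by (simp only: Q_norm)
    then have "m * 2 < c * pi * sqrt 3" by (simp add: algebra_simps)
    then show ?thesis by (simp add: D_def field_simps)
  qed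
  then have D': "0 < D / (2 * (2 * m + 1))" using m by simp
  then have k: "1 / sqrt 3 < k" by (simp add: k_def)
  then have "0 < k" by (meson less_trans zero_less_divide_1_iff real_sqrt_gt_zero zero_less_numeral)
  have "(1 / sqrt 3)\<^sup>2 < k\<^sup>2" using k by (intro power_strict_mono) auto
  then have "1 < 3 * k\<^sup>2" by (simp add: power_divide)
  then have \<delta>: "0 < \<delta>" using \<open>0 < k\<close> by (simp add: \<delta>_def field_simps)
  then have L: "0 < L" by (simp add: L_def)
  have subcritical: "2 * k * m < c * pi"
  proof -
    have "2 * m * (D / (2 * (2 * m + 1))) < D"
      using D m(1) by (simp add: field_simps add_pos_nonneg)
    moreover have "2 * k * m = 2 * m / sqrt 3 + 2 * m * (D / (2 * (2 * m + 1)))"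
      by (simp add: k_def algebra_simps)
    ultimately show ?thesis by (simp add: D_def)
  qed
  have "H1_norm N v \<le> sqrt (m + B)"
    if v: "v \<in> H1_D N" "radial N v \<or> c \<le> 1" "(graph_Lp_norm N 2 v)\<^sup>2 = m" "energy N \<gamma> v = E" for v
  proof -
    define X Y a where "X = (graph_Lp_norm N 2 (graph_deriv v))\<^sup>2" and "Y = graph_Lp_norm N 6 v ^ 6"
      and "a = (norm (vertex_value v))\<^sup>2"
    have "0 \<le> X" "0 \<le> a" by (simp_all add: X_def a_def)
    have "k\<^sup>2 * Y \<le> X"
      unfolding X_def Y_def
      by (rule star_graph_gagliardo_nirenberg[OF v(1) \<open>N \<ge> 1\<close> \<open>0 < k\<close> c v(2)]) (use subcritical v(3) in simp)
    then have "1 / 6 * Y \<le> X / (6 * k\<^sup>2)" using \<open>0 < k\<close> by (simp add: field_simps)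
    moreover have E: "E = 1 / 2 * X + \<gamma> / 2 * a - 1 / 6 * Y"
      using v(4) by (simp add: energy_def X_def Y_def a_def)
    ultimately have "\<delta> * X + \<gamma> / 2 * a \<le> E" by (simp add: \<delta>_def algebra_simps)
    moreover have "- (\<bar>\<gamma>\<bar> / 2 * a) \<le> \<gamma> / 2 * a"
      using \<open>0 \<le> a\<close> mult_right_mono[of "- \<bar>\<gamma>\<bar> / 2" "\<gamma> / 2" a] by auto
    moreover have "\<bar>\<gamma>\<bar> / 2 * a \<le> \<bar>\<gamma>\<bar> / 2 * (2 / L * m + 2 * L * X)"
      using star_graph_vertex_bound[OF v(1) \<open>N \<ge> 1\<close> L] v(3)
      by (intro mult_left_mono) (simp_all add: a_def X_def)
    moreover have "\<bar>\<gamma>\<bar> / 2 * (2 / L * m + 2 * L * X) = \<bar>\<gamma>\<bar> / L * m + \<bar>\<gamma>\<bar> * L * X"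
      by (simp add: field_simps)
    moreover have "\<bar>\<gamma>\<bar> * L * X \<le> \<delta> / 2 * X"
    proof (rule mult_right_mono)
      have "\<bar>\<gamma>\<bar> * \<delta> \<le> (\<bar>\<gamma>\<bar> + 1) * \<delta>" using \<delta> by (intro mult_right_mono) auto
      then show "\<bar>\<gamma>\<bar> * L \<le> \<delta> / 2" by (simp add: L_def field_simps)
    qed fact
    ultimately have "\<delta> * X \<le> E + \<bar>\<gamma>\<bar> / L * m + \<delta> / 2 * X" by linarith
    then have "\<delta> * X \<le> 2 * (E + \<bar>\<gamma>\<bar> / L * m)" by (simp add: field_simps)
    then have "X \<le> B" using \<delta> by (simp add: B_def field_simps)
    then show ?thesis
      unfolding H1_norm_eq using v(3) by (simp add: X_def)
  qed
  then show ?thesis by blast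
qed

text \<open>At the critical mass only \<open>k < 1 / sqrt 3\<close> is admissible. In the limit,
  kinetic and sextic terms together are still nonnegative, so the energy dominates the vertex
  term.\<close>

lemma critical_vertex_bound:
  assumes "N \<ge> 1" and c: "0 < c" "c \<le> real N / 2" "radial N v \<or> c \<le> 1" and v: "v \<in> H1_D N"
    and m: "(graph_Lp_norm N 2 v)\<^sup>2 = c * (Lp_norm lebesgue 2 Q)\<^sup>2"
  shows "\<gamma> / 2 * (norm (vertex_value v))\<^sup>2 \<le> energy N \<gamma> v"
proof -
  define X Y where "X = (graph_Lp_norm N 2 (graph_deriv v))\<^sup>2" and "Y = graph_Lp_norm N 6 v ^ 6"
  have "k\<^sup>2 * Y \<le> X" if k: "0 < k" "k < 1 / sqrt 3" for k
    unfolding X_def Y_def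
  proof (rule star_graph_gagliardo_nirenberg[OF v \<open>N \<ge> 1\<close> k(1) c(2,3)])
    have "2 * k * (c * (sqrt 3 * pi / 2)) = (k * sqrt 3) * (c * pi)" by simp
    also have "\<dots> < 1 * (c * pi)"
      using k c by (intro mult_strict_right_mono) (auto simp: field_simps)
    finally show "2 * k * (graph_Lp_norm N 2 v)\<^sup>2 < c * pi"
      by (simp add: m Q_norm)
  qed
  then have "\<forall>\<^sub>F k in at_left (1 / sqrt 3). k\<^sup>2 * Y \<le> X"
    by (intro eventually_at_leftI[of 0]) auto
  moreover have "((\<lambda>k. k\<^sup>2 * Y) \<longlongrightarrow> (1 / sqrt 3)\<^sup>2 * Y) (at_left (1 / sqrt 3))"
    by (intro tendsto_intros)
  ultimately have "(1 / sqrt 3)\<^sup>2 * Y \<le> X"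
    by (intro tendsto_upperbound) auto
  then have "Y \<le> 3 * X" by (simp add: power_divide)
  then show ?thesis by (simp add: energy_def X_def Y_def)
qed

text \<open>Times near a finite end lie in the interval, where blow-up contradicts the bound
  \<open>B\<close>.\<close>

lemma bounded_H1_norm_imp_global:
  assumes t0: "t0 \<in> time_interval Tmin Tmax"
    and bound: "\<And>t. t \<in> time_interval Tmin Tmax \<Longrightarrow> H1_norm N (u t) \<le> B"
    and right: "Tmax = \<infinity> \<or> filterlim (\<lambda>t. H1_norm N (u t)) at_top (at_left (real_of_ereal Tmax))"
    and left: "Tmin = -\<infinity> \<or> filterlim (\<lambda>t. H1_norm N (u t)) at_top (at_right (real_of_ereal Tmin))"
  shows "global_interval Tmin Tmax"
proof -
  have blowup: False
    if "filterlim (\<lambda>t. H1_norm N (u t)) at_top F" "\<forall>\<^sub>F t in F. t \<in> time_interval Tmin Tmax" "F \<noteq> bot" for F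
  proof -
    have "\<forall>\<^sub>F t in F. H1_norm N (u t) > B"
      using that(1) by (simp add: filterlim_at_top_dense)
    with that(2) have "\<forall>\<^sub>F t in F. False"
      by eventually_elim (use bound in force)
    then show False using that(3) by simp
  qed
  have "Tmax = \<infinity>"
  proof (rule ccontr)
    assume "Tmax \<noteq> \<infinity>"
    \<comment> \<open>Membership of \<open>t0\<close> rules out \<open>-\<infinity>\<close>, so
      \<open>real_of_ereal\<close> returns the actual end.\<close>
    then obtain r where r: "Tmax = ereal r"
      using t0 by (cases Tmax) (auto simp: time_interval_def)
    have "\<forall>\<^sub>F t in at_left r. t \<in> time_interval Tmin Tmax"
      by (rule eventually_at_leftI[of t0])
        (use t0 r in \<open>auto simp: time_interval_def intro: less_trans[of Tmin "ereal t0"]\<close>)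
    with right r show False using blowup[of "at_left r"] by simp
  qed
  moreover have "Tmin = -\<infinity>"
  proof (rule ccontr)
    assume "Tmin \<noteq> -\<infinity>"
    then obtain r where r: "Tmin = ereal r"
      using t0 by (cases Tmin) (auto simp: time_interval_def)
    have "\<forall>\<^sub>F t in at_right r. t \<in> time_interval Tmin Tmax"
      by (rule eventually_at_rightI[of _ t0])
        (use t0 r in \<open>auto simp: time_interval_def intro: less_trans[of _ "ereal t0"]\<close>)
    with left r show False using blowup[of "at_right r"] by simp
  qed
  ultimately show ?thesis by (simp add: global_interval_def)
qed

theorem proposition3p2:
  fixes N :: nat and \<gamma> t0 :: real and u0 :: graph_fun
    and Tmin Tmax :: ereal and u :: "real \<Rightarrow> graph_fun"
  assumes "N \<ge> 1"
    and "local_cauchy_theory N \<gamma>"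
    and "u0 \<in> H1_D N"
    and "maximal_solution N \<gamma> t0 u0 Tmin Tmax u"
  shows
    "((graph_Lp_norm N 2 u0)\<^sup>2 < min 1 (real N / 2) * (Lp_norm lebesgue 2 Q)\<^sup>2 \<longrightarrow>
        global_interval Tmin Tmax \<and> (\<forall>t. u t \<in> H1 N)) \<and>
     (\<gamma> > 0 \<and> (graph_Lp_norm N 2 u0)\<^sup>2 = min 1 (real N / 2) * (Lp_norm lebesgue 2 Q)\<^sup>2 \<longrightarrow>
        (\<exists>C. \<forall>t\<in>time_interval Tmin Tmax. norm (vertex_value (u t)) \<le> C)) \<and>
     (u0 \<in> H1_rad N \<and> (graph_Lp_norm N 2 u0)\<^sup>2 < (real N / 2) * (Lp_norm lebesgue 2 Q)\<^sup>2 \<longrightarrow>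
        global_interval Tmin Tmax \<and> (\<forall>t. u t \<in> H1_rad N)) \<and>
     (\<gamma> > 0 \<and> u0 \<in> H1_rad N \<and>
      (graph_Lp_norm N 2 u0)\<^sup>2 = (real N / 2) * (Lp_norm lebesgue 2 Q)\<^sup>2 \<longrightarrow>
        (\<exists>C. \<forall>t\<in>time_interval Tmin Tmax. norm (vertex_value (u t)) \<le> C))"
proof -
  let ?I = "time_interval Tmin Tmax" and ?q = "(Lp_norm lebesgue 2 Q)\<^sup>2"
  have t0: "t0 \<in> ?I" and H1_D: "\<And>t. t \<in> ?I \<Longrightarrow> u t \<in> H1_D N"
    using assms(4) by (auto simp: maximal_solution_def nls_solution_def Let_def)
  have cauchy:
    "radial N u0 \<longrightarrow> (\<forall>t\<in>?I. radial N (u t))"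
    "\<forall>t\<in>?I. energy N \<gamma> (u t) = energy N \<gamma> u0 \<and> mass N (u t) = mass N u0"
    "Tmax = \<infinity> \<or> filterlim (\<lambda>t. H1_norm N (u t)) at_top (at_left (real_of_ereal Tmax))"
    "Tmin = -\<infinity> \<or> filterlim (\<lambda>t. H1_norm N (u t)) at_top (at_right (real_of_ereal Tmin))"
    using assms(2)[unfolded local_cauchy_theory_def, rule_format, OF assms(3)] assms(4) by blast+
  have mass: "(graph_Lp_norm N 2 (u t))\<^sup>2 = (graph_Lp_norm N 2 u0)\<^sup>2" if "t \<in> ?I" for t
    using cauchy(2) that by (simp add: mass_def)
  \<comment> \<open>Both parts at once: \<open>c\<close> is \<open>min 1 (real N / 2)\<close> for
    general data and \<open>real N / 2\<close> for radial data.\<close>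
  have global: "global_interval Tmin Tmax \<and> (\<forall>t. u t \<in> H1_D N) \<and> (radial N u0 \<longrightarrow> (\<forall>t. radial N (u t)))"
    if c: "c \<le> real N / 2" "radial N u0 \<or> c \<le> 1" and sub: "(graph_Lp_norm N 2 u0)\<^sup>2 < c * ?q" for c
  proof -
    obtain B where "\<forall>v\<in>H1_D N. (radial N v \<or> c \<le> 1) \<and> (graph_Lp_norm N 2 v)\<^sup>2 = (graph_Lp_norm N 2 u0)\<^sup>2 \<and>
        energy N \<gamma> v = energy N \<gamma> u0 \<longrightarrow> H1_norm N v \<le> B"
      using subcritical_H1_bound[OF assms(1) c(1) zero_le_power2 sub] by blast
    then have "H1_norm N (u t) \<le> B" if "t \<in> ?I" for t
      using that H1_D mass cauchy(1,2) c(2) by blast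
    then have "global_interval Tmin Tmax"
      using bounded_H1_norm_imp_global[OF t0 _ cauchy(3,4)] by blast
    \<comment> \<open>Globality turns statements on the existence interval into statements for all
      \<open>t\<close>.\<close>
    moreover from this have "?I = UNIV"
      by (auto simp: global_interval_def time_interval_def)
    ultimately show ?thesis using H1_D cauchy(1) by auto
  qed
  have vertex: "\<exists>C. \<forall>t\<in>?I. norm (vertex_value (u t)) \<le> C"
    if "\<gamma> > 0" and c: "0 < c" "c \<le> real N / 2" "radial N u0 \<or> c \<le> 1"
      and crit: "(graph_Lp_norm N 2 u0)\<^sup>2 = c * ?q" for c
  proof (intro exI ballI)
    fix t assume t: "t \<in> ?I"
    have "\<gamma> / 2 * (norm (vertex_value (u t)))\<^sup>2 \<le> energy N \<gamma> (u t)"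
      using t c cauchy(1) mass crit by (intro critical_vertex_bound[OF assms(1) c(1,2) _ H1_D]) auto
    then have "(norm (vertex_value (u t)))\<^sup>2 \<le> 2 * energy N \<gamma> u0 / \<gamma>"
      using \<open>\<gamma> > 0\<close> cauchy(2) t by (simp add: field_simps)
    then show "norm (vertex_value (u t)) \<le> sqrt (2 * energy N \<gamma> u0 / \<gamma>)"
      by (rule real_le_rsqrt)
  qed
  have H1_rad: "H1_D N \<subseteq> H1 N" "\<And>v. v \<in> H1_rad N \<longleftrightarrow> v \<in> H1 N \<and> radial N v"
    by (auto simp: H1_D_def H1_rad_def)
  show ?thesis
    using global[of "min 1 (real N / 2)"] vertex[of "min 1 (real N / 2)"]
      global[of "real N / 2"] vertex[of "real N / 2"] assms(1) H1_rad
    by (intro conjI impI) auto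
qed

end
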